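(* Assume the setting below. Let $H>G$ be a constant, assume $h<1$ and $Hh^r<1$, and let $$M_2=M_1+\frac{G}{H}\Big[\frac{\mu}{1-[(G/H)h]^2}\Big]\frac{1}{[\sin(\pi/(2r+2))]^2}.$$ Suppose $0<M'<M$, $M\ge M_2$, and $\mathbf{L}_{s,\nu}(K_M(T))\subset K_{M'}(T)$. Then, with $R(\mathbf{L}_{s,\nu})$ the spectral radius of $\mathbf{L}_{s,\nu}$, $$\big[(1+Hh^r)^{-1}R(\mathbf{L}_{s,\nu})\big]^{1/\nu}\le\lambda_s\le\big[(1-Hh^r)^{-1}R(\mathbf{L}_{s,\nu})\big]^{1/\nu}.$$
   Context: Setting. Let $a<b$, $S=[a,b]$, $n\ge1$, $s>0$, integers $r\ge1$, $m\ge r+1$. For $1\le p\le n$, $\theta_p:S\to S$ and $g_p:S\to[0,\infty)$ are $C^m$, $g_p$ not identically zero, and there is $M_0>0$ with $g_p(t_1)\le g_p(t_2)e^{M_0|t_1-t_2|}$ for all $t_1,t_2\in S$. For $\nu\ge1$, $\Omega_\nu=\{1,\dots,n\}^\nu$; for $\omega=(p_1,\dots,p_\nu)$, $\theta_\omega=\theta_{p_1}\circ\cdots\circ\theta_{p_\nu}$, $g_\omega(t)=g_{p_1}(\theta_{p_2}\circ\cdots\circ\theta_{p_\nu}(t))\cdots g_{p_{\nu-1}}(\theta_{p_\nu}(t))g_{p_\nu}(t)$. There are $C_0\ge1$, $0<\kappa<1$ with $|\theta_\omega(t_1)-\theta_\omega(t_2)|\le C_0\kappa^\nu|t_1-t_2|$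 for all $\nu,\omega,t_1,t_2$. $(L_sf)(t)=\sum_pg_p(t)^sf(\theta_p(t))$ on $C(S)$; $\lambda_s$ its spectral radius; $v_s\in C^m(S)$ a strictly positive eigenfunction with $L_sv_s=\lambda_sv_s$ (which exists under these hypotheses). $E,\chi>0$ satisfy $\sup_S|v_s^{(r+1)}|/v_s\le E$ and $v_s(x_1)\le v_s(x_2)e^{2s|x_1-x_2|/\chi}$ on $S$. A positive integer $\nu$ is fixed; pairwise disjoint nonempty compact intervals $[a_i,b_i]\subset S$, $1\le i\le I$, $b_i<a_{i+1}$, such that each $\theta_\omega(S)$, $\omega\in\Omega_\nu$, lies in some $[a_i,b_i]$. Positive integers $N_i$; $h_i=(b_i-a_i)/N_i$, $h=\max_ih_i$, $\mu=h/\min_ih_i$, $t^i_j=a_i+jh_i$; assume $2[\sin(\pi/(2r+2))]^2h_i\le a_{i+1}-b_i$ for $1\le i<I$. $\hat c_k=-\cos(\tfrac{2k+1}{2r+2}\pi)/\cos(\tfrac{\pi}{2r+2})$, $c^i_{j,k}=t^i_{j-1}+h_i(1+\hat c_k)/2$; $T$ is the set of all $c^i_{j,k}$. For $F:T\to\mathbb{R}$, $\mathcal{F}$ is the continuous function on $\bigcup_i[a_i,b_i]$ equal on each $[t^i_{j-1},t^i_j]$ to the polynomial of degree $\le r$ interpolating $F$ at $c^i_{j,0},\dots,c^i_{j,r}$. $K_M(T)=\{F:T\to\mathbb{R}:F(\xi)\le e^{M|\xi-\eta|}F(\eta)\ \forall\xi,\eta\in T\}$; $(\mathbf{L}_{s,\nu}F)(\xi)=\sum_{\omega\in\Omega_\nu}g_\omega(\xi)^s\mathcal{F}(\theta_\omega(\xi))$,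 $\xi\in T$. $G=E\,e^{2sh/\chi}\frac{1}{(r+1)!}\big[\frac{1}{2\cos(\pi/(2r+2))}\big]^{r+1}\frac{1}{2^r}$; assume $Gh^{r+1}<1$; $M_1=\mu\frac{Gh^r}{1-G^2h^{2r+2}}\big[\frac{1}{\sin(\pi/(2r+2))}\big]^2+\frac{2s}{\chi}$. *)

theory Defs
  imports "HOL-Analysis.Analysis" "HOL-Computational_Algebra.Polynomial"
begin

section \<open>Functions of class \<open>C\<^sup>m\<close> on a set\<close>

text \<open>Derivatives are taken within \<open>S\<close>, hence are one-sided at the end points of an interval.\<close>

primrec nth_deriv_within :: "real set \<Rightarrow> nat \<Rightarrow> (real \<Rightarrow> real) \<Rightarrow> real \<Rightarrow> real" where
  "nth_deriv_within S 0 f = f"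
| "nth_deriv_within S (Suc k) f = (\<lambda>x. vector_derivative (nth_deriv_within S k f) (at x within S))"

definition C_class_on :: "nat \<Rightarrow> real set \<Rightarrow> (real \<Rightarrow> real) \<Rightarrow> bool" where
  "C_class_on m S f \<longleftrightarrow>
     (\<forall>k<m. \<forall>x\<in>S. nth_deriv_within S k f differentiable (at x within S)) \<and>
     continuous_on S (nth_deriv_within S m f)"

section \<open>Spectral radius of a linear operator on \<open>C(K)\<close>\<close>

text \<open>
  The complex Banach space \<open>C(K)\<close>, \<open>K\<close> compact, is represented by the functions that are continuous
  on \<open>K\<close> and vanish outside \<open>K\<close>. For finite \<open>K\<close> these are all complex functions on \<open>K\<close>.
  An operator acting on real functions is identified with its complexification.
\<close>

definition cont_space :: "real set \<Rightarrow> (real \<Rightarrow> complex) set" where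
  "cont_space K = {f. continuous_on K f \<and> (\<forall>x. x \<notin> K \<longrightarrow> f x = 0)}"

definition sup_norm_on :: "real set \<Rightarrow> (real \<Rightarrow> complex) \<Rightarrow> real" where
  "sup_norm_on K f = (SUP x\<in>K. norm (f x))"

definition complexification ::
    "((real \<Rightarrow> real) \<Rightarrow> real \<Rightarrow> real) \<Rightarrow> (real \<Rightarrow> complex) \<Rightarrow> real \<Rightarrow> complex" where
  "complexification L f x = Complex (L (\<lambda>t. Re (f t)) x) (L (\<lambda>t. Im (f t)) x)"

definition shifted_op ::
    "real set \<Rightarrow> ((real \<Rightarrow> real) \<Rightarrow> real \<Rightarrow> real) \<Rightarrow> complex \<Rightarrow> (real \<Rightarrow> complex) \<Rightarrow> real \<Rightarrow> complex" where
  "shifted_op K L z f = (\<lambda>x. if x \<in> K then z * f x - complexification L f x else 0)"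

definition op_spectrum :: "real set \<Rightarrow> ((real \<Rightarrow> real) \<Rightarrow> real \<Rightarrow> real) \<Rightarrow> complex set" where
  "op_spectrum K L = {z. \<not> (bij_betw (shifted_op K L z) (cont_space K) (cont_space K) \<and>
     (\<exists>B. \<forall>f\<in>cont_space K. sup_norm_on K f \<le> B * sup_norm_on K (shifted_op K L z f)))}"

definition op_spectral_radius :: "real set \<Rightarrow> ((real \<Rightarrow> real) \<Rightarrow> real \<Rightarrow> real) \<Rightarrow> real" where
  "op_spectral_radius K L = (SUP z\<in>op_spectrum K L. norm z)"

section \<open>Iterated function systems and the transfer operator\<close>

definition words :: "nat \<Rightarrow> nat \<Rightarrow> nat list set" where
  "words n \<nu> = {\<omega>. length \<omega> = \<nu> \<and> set \<omega> \<subseteq> {1..n}}"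

primrec word_map :: "(nat \<Rightarrow> real \<Rightarrow> real) \<Rightarrow> nat list \<Rightarrow> real \<Rightarrow> real" where
  "word_map \<theta> [] = id"
| "word_map \<theta> (p # \<omega>) = \<theta> p \<circ> word_map \<theta> \<omega>"

primrec word_weight ::
    "(nat \<Rightarrow> real \<Rightarrow> real) \<Rightarrow> (nat \<Rightarrow> real \<Rightarrow> real) \<Rightarrow> nat list \<Rightarrow> real \<Rightarrow> real" where
  "word_weight \<theta> g [] t = 1"
| "word_weight \<theta> g (p # \<omega>) t = g p (word_map \<theta> \<omega> t) * word_weight \<theta> g \<omega> t"

definition transfer_op ::
    "nat \<Rightarrow> (nat \<Rightarrow> real \<Rightarrow> real) \<Rightarrow> (nat \<Rightarrow> real \<Rightarrow> real) \<Rightarrow> real \<Rightarrow> (real \<Rightarrow> real) \<Rightarrow> real \<Rightarrow> real" where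
  "transfer_op n \<theta> g s f t = (\<Sum>p=1..n. g p t powr s * f (\<theta> p t))"

section \<open>Piecewise polynomial interpolation at extended Chebyshev points\<close>

definition mesh :: "(nat \<Rightarrow> real) \<Rightarrow> (nat \<Rightarrow> real) \<Rightarrow> (nat \<Rightarrow> nat) \<Rightarrow> nat \<Rightarrow> real" where
  "mesh A B N i = (B i - A i) / real (N i)"

definition mesh_pt :: "(nat \<Rightarrow> real) \<Rightarrow> (nat \<Rightarrow> real) \<Rightarrow> (nat \<Rightarrow> nat) \<Rightarrow> nat \<Rightarrow> nat \<Rightarrow> real" where
  "mesh_pt A B N i j = A i + real j * mesh A B N i"

definition cheb_pt :: "nat \<Rightarrow> nat \<Rightarrow> real" where
  "cheb_pt r k = - cos ((2 * real k + 1) / (2 * real r + 2) * pi) / cos (pi / (2 * real r + 2))"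

definition colloc_pt ::
    "(nat \<Rightarrow> real) \<Rightarrow> (nat \<Rightarrow> real) \<Rightarrow> (nat \<Rightarrow> nat) \<Rightarrow> nat \<Rightarrow> nat \<Rightarrow> nat \<Rightarrow> nat \<Rightarrow> real" where
  "colloc_pt A B N r i j k = mesh_pt A B N i (j - 1) + mesh A B N i * (1 + cheb_pt r k) / 2"

definition colloc_set ::
    "(nat \<Rightarrow> real) \<Rightarrow> (nat \<Rightarrow> real) \<Rightarrow> (nat \<Rightarrow> nat) \<Rightarrow> nat \<Rightarrow> nat \<Rightarrow> real set" where
  "colloc_set A B N I r = {colloc_pt A B N r i j k | i j k. i \<in> {1..I} \<and> j \<in> {1..N i} \<and> k \<le> r}"

text \<open>
  The value of the interpolant at a common end point of two adjacent subintervals does not depend on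
  the subinterval used, because \<open>cheb_pt r 0 = -1\<close> and \<open>cheb_pt r r = 1\<close>, so that the mesh points are
  themselves interpolation points. Functions on the point set are represented by total functions
  of which only the values on that set matter.
\<close>

definition pw_interp ::
    "(nat \<Rightarrow> real) \<Rightarrow> (nat \<Rightarrow> real) \<Rightarrow> (nat \<Rightarrow> nat) \<Rightarrow> nat \<Rightarrow> nat \<Rightarrow> (real \<Rightarrow> real) \<Rightarrow> real \<Rightarrow> real" where
  "pw_interp A B N I r F x =
     (THE y. \<exists>i\<in>{1..I}. \<exists>j\<in>{1..N i}. \<exists>P :: real poly.
        x \<in> {mesh_pt A B N i (j - 1)..mesh_pt A B N i j} \<and> degree P \<le> r \<and>
        (\<forall>k\<le>r. poly P (colloc_pt A B N r i j k) = F (colloc_pt A B N r i j k)) \<and>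
        y = poly P x)"

definition log_lip_cone :: "real \<Rightarrow> real set \<Rightarrow> (real \<Rightarrow> real) set" where
  "log_lip_cone M T = {F. \<forall>\<xi>\<in>T. \<forall>\<eta>\<in>T. F \<xi> \<le> exp (M * \<bar>\<xi> - \<eta>\<bar>) * F \<eta>}"

definition discrete_op ::
    "nat \<Rightarrow> (nat \<Rightarrow> real \<Rightarrow> real) \<Rightarrow> (nat \<Rightarrow> real \<Rightarrow> real) \<Rightarrow> real \<Rightarrow> nat \<Rightarrow>
     (nat \<Rightarrow> real) \<Rightarrow> (nat \<Rightarrow> real) \<Rightarrow> (nat \<Rightarrow> nat) \<Rightarrow> nat \<Rightarrow> nat \<Rightarrow>
     (real \<Rightarrow> real) \<Rightarrow> real \<Rightarrow> real" where
  "discrete_op n \<theta> g s \<nu> A B N I r F \<xi> =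
     (\<Sum>\<omega>\<in>words n \<nu>. word_weight \<theta> g \<omega> \<xi> powr s * pw_interp A B N I r F (word_map \<theta> \<omega> \<xi>))"

end

theory Submission
  imports Defs "Jordan_Normal_Form.Spectral_Radius"
begin

text \<open>
  Let \<open>L\<close> be the discrete operator and \<open>w\<close> the restriction of \<open>v\<close> to \<open>T\<close>. The interpolation error at
  the extended Chebyshev points gives \<open>\<bar>L w - \<lambda>\<^sup>\<nu> w\<bar> \<le> G h\<^bsup>r+1\<^esup> \<lambda>\<^sup>\<nu> w\<close> pointwise. The matrix of \<open>L\<close> may
  have negative entries, so this says nothing about its spectral radius in the pointwise order; the order
  to use is that of the invariant cone \<open>K\<^sub>M(T)\<close>. Both \<open>(1 + H h\<^sup>r) \<lambda>\<^sup>\<nu> w - L w\<close> and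
  \<open>L w - (1 - H h\<^sup>r) \<lambda>\<^sup>\<nu> w\<close> differ from \<open>H h\<^sup>r \<lambda>\<^sup>\<nu> w\<close> by a relative error of at most \<open>(G / H) h\<close>. As
  distinct points of \<open>T\<close> are at least \<open>2 sin\<^sup>2 (\<pi> / (2 r + 2)) h / \<mu>\<close> apart, such a perturbation raises the
  logarithmic Lipschitz constant by a bounded amount only, so that both functions lie in \<open>K\<^sub>M(T)\<close>.
  The two bounds are then those of Collatz and Wielandt for the order of the cone.
\<close>

section \<open>Spectral radius of operators on finite sets\<close>

text \<open>The width of the window explains both \<open>H\<close> and the shape of
  \<open>M\<^sub>2\<close>. The consistency error has order h^(r+1). A window of that same order
  would leave a relative error x that does not shrink with h; divided by the separation of
  \<open>T\<close>, which does shrink like h, it would cost a Lipschitz constant of order 1/h.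
  Giving up one power of h makes x = (G/H) h, and h cancels: 2x / (1 - x^2) divided by 2
  sin^2(\<alpha>) h / \<mu> is exactly the summand that \<open>M\<^sub>2\<close> adds to
  \<open>M\<^sub>1\<close>. The spectrum is complex, whereas the cone orders real functions; the
  link is the growth of iterates. For the lower bound it is enough that the one function w grows
  fast. For the upper bound every real function has to be dominated by a multiple of w in the order
  of the cone. This is why 2s / \<chi> < M must be strict: it puts w into the interior of the
  cone.\<close>

lemma sup_norm_on_upper:
  assumes "finite T" "x \<in> T"
  shows "norm (f x) \<le> sup_norm_on T f"
  unfolding sup_norm_on_def using assms by (intro cSUP_upper bdd_above_finite) auto

lemma cont_space_finite:
  assumes "finite T"
  shows "cont_space T = {f. \<forall>x. x \<notin> T \<longrightarrow> f x = 0}"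
  unfolding cont_space_def using assms by (auto intro: continuous_on_finite)

text \<open>This says that \<open>L\<close> acts on functions on \<open>T\<close> as the matrix
  \<open>W\<close>. Values of \<open>L f\<close> off \<open>T\<close> are left free, because
  functions on \<open>T\<close> are represented by total functions and the discrete operator
  produces arbitrary values elsewhere.\<close>

definition has_kernel_on ::
    "real set \<Rightarrow> (real \<Rightarrow> real \<Rightarrow> real) \<Rightarrow> ((real \<Rightarrow> real) \<Rightarrow> real \<Rightarrow> real) \<Rightarrow> bool" where
  "has_kernel_on T W L \<longleftrightarrow> (\<forall>f. \<forall>x\<in>T. L f x = (\<Sum>y\<in>T. W x y * f y))"

lemma has_kernel_onD: "has_kernel_on T W L \<Longrightarrow> x \<in> T \<Longrightarrow> L f x = (\<Sum>y\<in>T. W x y * f y)"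
  by (simp add: has_kernel_on_def)

lemma complexification_kernel:
  assumes "has_kernel_on T W L" "x \<in> T"
  shows "complexification L f x = (\<Sum>y\<in>T. of_real (W x y) * f y)"
  unfolding complexification_def has_kernel_onD[OF assms] by (auto simp: complex_eq_iff)

text \<open>Every function on a finite set is continuous, so an enumeration \<open>e\<close> of
  \<open>T\<close> identifies C(T) with complex d-vectors. If z is no eigenvalue, the inverse matrix
  supplies both the bijectivity and the norm bound demanded by \<open>op_spectrum\<close>; if it is
  one, a kernel vector destroys injectivity.\<close>

lemma op_spectrum_finite:
  fixes L :: "(real \<Rightarrow> real) \<Rightarrow> real \<Rightarrow> real"
  assumes fin: "finite T" and ne: "T \<noteq> {}"
    and kern: "has_kernel_on T W L"
    and e: "bij_betw e {..<d} T"
  shows "op_spectrum T L =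
    Collect (eigenvalue (Matrix.mat d d (\<lambda>(i, j). complex_of_real (W (e i) (e j)))))"
proof (rule Set.set_eqI)
  fix z
  define A where "A = Matrix.mat d d (\<lambda>(i, j). complex_of_real (W (e i) (e j)))"
  define idx where "idx = the_inv_into {..<d} e"
  define \<phi> where "\<phi> f = Matrix.vec d (\<lambda>i. f (e i))" for f :: "real \<Rightarrow> complex"
  define \<psi> where "\<psi> u = (\<lambda>x. if x \<in> T then vec_index u (idx x) else (0::complex))" for u
  have A[simp]: "A \<in> carrier_mat d d" by (simp add: A_def)
  have e_in[simp]: "e i \<in> T" if "i < d" for i using e that by (auto simp: bij_betw_def)
  have idx_e[simp]: "idx (e i) = i" if "i < d" for i
    using e that unfolding idx_def bij_betw_def by (simp add: the_inv_into_f_f)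
  have e_idx[simp]: "e (idx x) = x" "idx x < d" if "x \<in> T" for x
    using e that f_the_inv_into_f_bij_betw[OF e, of x] the_inv_into_into[of e "{..<d}" x "{..<d}"]
    unfolding idx_def bij_betw_def by auto
  have \<phi>[simp]: "\<phi> f \<in> carrier_vec d" for f by (simp add: \<phi>_def)
  have \<phi>\<psi>[simp]: "\<phi> (\<psi> u) = u" if "u \<in> carrier_vec d" for u
    using that by (auto simp: \<phi>_def \<psi>_def)
  have \<psi>\<phi>[simp]: "\<psi> (\<phi> f) = f" if "f \<in> cont_space T" for f
    using that by (auto simp: \<phi>_def \<psi>_def cont_space_def fun_eq_iff)
  have \<psi>[simp]: "\<psi> u \<in> cont_space T" for u using fin by (auto simp: cont_space_finite \<psi>_def)
  have A\<phi>: "vec_index (A *\<^sub>v \<phi> f) i = complexification L f (e i)" if "i < d" for f i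
  proof -
    have "complexification L f (e i) = (\<Sum>y\<in>T. of_real (W (e i) y) * f y)"
      using that by (intro complexification_kernel kern) auto
    also have "\<dots> = (\<Sum>j<d. of_real (W (e i) (e j)) * f (e j))"
      by (rule sum.reindex_bij_betw[OF e, symmetric])
    finally show ?thesis
      using that by (simp add: A_def \<phi>_def scalar_prod_def lessThan_atLeast0)
  qed
  define D where "D = char_matrix A z"
  have D[simp]: "D \<in> carrier_mat d d" by (simp add: D_def)
  have D\<phi>: "vec_index (D *\<^sub>v \<phi> f) i = complexification L f (e i) - z * f (e i)" if "i < d" for f i
  proof -
    have "D *\<^sub>v \<phi> f = A *\<^sub>v \<phi> f + (-z) \<cdot>\<^sub>v \<phi> f"
      unfolding D_def char_matrix_def
    proof (rule eq_vecI)
      fix i assume "i < dim_vec (A *\<^sub>v \<phi> f + (-z) \<cdot>\<^sub>v \<phi> f)"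
      hence i: "i < d" using carrier_vecD[OF \<phi>] by simp
      show "vec_index ((A + (-z) \<cdot>\<^sub>m 1\<^sub>m (dim_row A)) *\<^sub>v \<phi> f) i = vec_index (A *\<^sub>v \<phi> f + (-z) \<cdot>\<^sub>v \<phi> f) i"
        using i carrier_matD[OF A] by (simp add: add_scalar_prod_distrib[of _ d] carrier_vecD[OF \<phi>])
    qed (simp add: A_def \<phi>_def)
    thus ?thesis using that A\<phi>[OF that] by (simp add: \<phi>_def A_def del: index_mult_mat_vec)
  qed
  \<comment> \<open>The sign appears because \<open>shifted_op\<close> is z - L whereas
    \<open>char_matrix\<close> is A - z.\<close>
  have shift: "shifted_op T L z f = \<psi> (- (D *\<^sub>v \<phi> f))" for f
  proof
    fix x show "shifted_op T L z f x = \<psi> (- (D *\<^sub>v \<phi> f)) x"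
    proof (cases "x \<in> T")
      case True
      have "idx x < dim_vec (D *\<^sub>v \<phi> f)" using True carrier_matD[OF D] by simp
      with True D\<phi>[of "idx x" f] show ?thesis by (simp add: shifted_op_def \<psi>_def del: index_mult_mat_vec)
    qed (simp add: shifted_op_def \<psi>_def)
  qed
  have ev: "eigenvalue A z" if "z \<in> op_spectrum T L"
  proof (rule ccontr)
    assume "\<not> eigenvalue A z"
    hence "det D \<noteq> 0" using eigenvalue_det[OF A] by (simp add: D_def)
    from det_non_zero_imp_unit[OF D this, unfolded Units_def, of "()"]
    obtain V where V[simp]: "V \<in> carrier_mat d d" and VD: "V * D = 1\<^sub>m d" and DV: "D * V = 1\<^sub>m d"
      by (auto simp: ring_mat_def)
    define J where "J f = \<psi> (- (V *\<^sub>v \<phi> f))" for f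
    have neg: "X *\<^sub>v (- u) = - (X *\<^sub>v u)" if "X \<in> carrier_mat d d" "u \<in> carrier_vec d" for X :: "complex mat" and u
      using that by (intro eq_vecI) (auto simp: scalar_prod_def sum_negf)
    have J1: "J (shifted_op T L z f) = f" if "f \<in> cont_space T" for f
    proof -
      have c: "D *\<^sub>v \<phi> f \<in> carrier_vec d" by (rule mult_mat_vec_carrier[OF D \<phi>])
      have "V *\<^sub>v (D *\<^sub>v \<phi> f) = \<phi> f"
        using assoc_mult_mat_vec[OF V D \<phi>[of f]] VD one_mult_mat_vec[OF \<phi>[of f]] by simp
      moreover have "\<phi> (\<psi> (- (D *\<^sub>v \<phi> f))) = - (D *\<^sub>v \<phi> f)"
        using c by (intro \<phi>\<psi>) auto
      ultimately have "J (shifted_op T L z f) = \<psi> (- (- \<phi> f))"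
        unfolding J_def shift using neg[OF V c] by simp
      thus ?thesis using that by simp
    qed
    have J2: "shifted_op T L z (J f) = f" if "f \<in> cont_space T" for f
    proof -
      have c: "V *\<^sub>v \<phi> f \<in> carrier_vec d" by (rule mult_mat_vec_carrier[OF V \<phi>])
      have "D *\<^sub>v (V *\<^sub>v \<phi> f) = \<phi> f"
        using assoc_mult_mat_vec[OF D V \<phi>[of f]] DV one_mult_mat_vec[OF \<phi>[of f]] by simp
      moreover have "\<phi> (\<psi> (- (V *\<^sub>v \<phi> f))) = - (V *\<^sub>v \<phi> f)"
        using c by (intro \<phi>\<psi>) auto
      ultimately have "shifted_op T L z (J f) = \<psi> (- (- \<phi> f))"
        unfolding J_def shift using neg[OF D c] by simp
      thus ?thesis using that by simp
    qed
    have bij: "bij_betw (shifted_op T L z) (cont_space T) (cont_space T)"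
    proof (rule bij_betw_byWitness[where f' = J])
      show "shifted_op T L z ` cont_space T \<subseteq> cont_space T" by (auto simp: shift)
      show "J ` cont_space T \<subseteq> cont_space T" by (auto simp: J_def)
    qed (auto simp: J1 J2)
    \<comment> \<open>The sum of the moduli of all entries of the inverse is a crude bound for its
      operator norm with respect to the sup norm.\<close>
    define C where "C = (\<Sum>i<d. \<Sum>j<d. norm (V $$ (i, j)))"
    have "sup_norm_on T f \<le> C * sup_norm_on T (shifted_op T L z f)" if f: "f \<in> cont_space T" for f
      unfolding sup_norm_on_def[of T f]
    proof (rule cSUP_least[OF ne])
      fix x assume x: "x \<in> T"
      let ?F = "shifted_op T L z f" and ?i = "idx x"
      have i: "?i < d" using x by simp
      have "f x = J ?F x" by (simp add: J1[OF f])
      also have "\<dots> = - (\<Sum>j<d. V $$ (?i, j) * ?F (e j))"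
        using x i V carrier_matD[OF V] by (simp add: J_def \<psi>_def scalar_prod_def \<phi>_def lessThan_atLeast0)
      finally have "norm (f x) \<le> (\<Sum>j<d. norm (V $$ (?i, j) * ?F (e j)))"
        by (simp add: norm_sum)
      also have "\<dots> \<le> (\<Sum>j<d. norm (V $$ (?i, j)) * sup_norm_on T ?F)"
        by (intro sum_mono) (auto simp: norm_mult intro!: mult_left_mono sup_norm_on_upper fin)
      also have "\<dots> = (\<Sum>j<d. norm (V $$ (?i, j))) * sup_norm_on T ?F" by (simp add: sum_distrib_right)
      also have "\<dots> \<le> C * sup_norm_on T ?F"
      proof (rule mult_right_mono)
        show "(\<Sum>j<d. norm (V $$ (?i, j))) \<le> C" unfolding C_def
          using i by (intro member_le_sum) (auto intro: sum_nonneg)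
        show "0 \<le> sup_norm_on T ?F" using sup_norm_on_upper[OF fin x, of ?F] norm_ge_zero order_trans by blast
      qed
      finally show "norm (f x) \<le> C * sup_norm_on T ?F" .
    qed
    hence "z \<notin> op_spectrum T L" using bij by (auto simp: op_spectrum_def)
    with that show False by blast
  qed
  have "z \<in> op_spectrum T L" if ev: "eigenvalue A z"
  proof -
    from ev obtain u where u: "u \<in> carrier_vec d" "u \<noteq> 0\<^sub>v d" "D *\<^sub>v u = 0\<^sub>v d"
      unfolding eigenvalue_char_matrix[OF A] D_def by auto
    have z0: "D *\<^sub>v 0\<^sub>v d = 0\<^sub>v d" using carrier_matD[OF D] by (intro eq_vecI) auto
    have "shifted_op T L z (\<psi> u) = shifted_op T L z (\<psi> (0\<^sub>v d))"
      using u z0 by (simp add: shift)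
    moreover have "\<psi> u \<noteq> \<psi> (0\<^sub>v d)" using u \<phi>\<psi> zero_carrier_vec by metis
    ultimately have "\<not> inj_on (shifted_op T L z) (cont_space T)"
      using \<psi> unfolding inj_on_def by blast
    thus ?thesis by (auto simp: op_spectrum_def bij_betw_def)
  qed
  with ev show "z \<in> op_spectrum T L \<longleftrightarrow> z \<in> Collect (eigenvalue A)" by auto
qed

text \<open>A form free of the enumeration, so that the growth arguments below can work with
  functions on \<open>T\<close> instead of vectors.\<close>

lemma op_spectrum_finite_iff_eigenfunction:
  fixes L :: "(real \<Rightarrow> real) \<Rightarrow> real \<Rightarrow> real"
  assumes fin: "finite T" and ne: "T \<noteq> {}"
    and kern: "has_kernel_on T W L"
  shows "z \<in> op_spectrum T L \<longleftrightarrow>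
    (\<exists>f. (\<exists>x\<in>T. f x \<noteq> 0) \<and> (\<forall>x\<in>T. (\<Sum>y\<in>T. of_real (W x y) * f y) = z * f x))"
proof -
  obtain e where e: "bij_betw e {..<card T} T"
    using ex_bij_betw_nat_finite[OF fin] by (auto simp: lessThan_atLeast0)
  define d where "d = card T"
  define A where "A = Matrix.mat d d (\<lambda>(i, j). complex_of_real (W (e i) (e j)))"
  have e: "bij_betw e {..<d} T" using e by (simp add: d_def)
  have spec: "z \<in> op_spectrum T L \<longleftrightarrow> eigenvalue A z"
    using op_spectrum_finite[OF fin ne kern e] by (simp add: A_def)
  have e_in: "e i \<in> T" if "i < d" for i using e that by (auto simp: bij_betw_def)
  have e_ex: "\<exists>i<d. x = e i" if "x \<in> T" for x using e that by (auto simp: bij_betw_def)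
  have re: "(\<Sum>y\<in>T. of_real (W x y) * f y) = (\<Sum>j<d. of_real (W x (e j)) * f (e j))"
    for x and f :: "real \<Rightarrow> complex"
    by (rule sum.reindex_bij_betw[OF e, symmetric])
  have Av: "vec_index (A *\<^sub>v u) i = (\<Sum>j<d. of_real (W (e i) (e j)) * vec_index u j)"
    if "i < d" "u \<in> carrier_vec d" for u i
    using that carrier_vecD[OF that(2)] by (simp add: A_def scalar_prod_def lessThan_atLeast0)
  show ?thesis unfolding spec
  proof
    assume "eigenvalue A z"
    then obtain u where u: "u \<in> carrier_vec d" "u \<noteq> 0\<^sub>v d" "A *\<^sub>v u = z \<cdot>\<^sub>v u"
      by (auto simp: eigenvalue_def eigenvector_def A_def)
    define f where "f x = vec_index u (the_inv_into {..<d} e x)" for x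
    have fe: "f (e i) = vec_index u i" if "i < d" for i
      using e that unfolding f_def bij_betw_def by (simp add: the_inv_into_f_f)
    have "\<exists>i<d. vec_index u i \<noteq> 0"
    proof (rule ccontr)
      assume "\<not> ?thesis"
      hence "u = 0\<^sub>v d" using u(1) by (intro eq_vecI) auto
      with u(2) show False by simp
    qed
    hence "\<exists>x\<in>T. f x \<noteq> 0" using fe e_in by metis
    moreover have "(\<Sum>y\<in>T. of_real (W x y) * f y) = z * f x" if x: "x \<in> T" for x
    proof -
      obtain i where i: "i < d" "x = e i" using e_ex[OF x] by blast
      have "(\<Sum>y\<in>T. of_real (W x y) * f y) = vec_index (A *\<^sub>v u) i"
        unfolding re Av[OF i(1) u(1)] i(2) by (rule sum.cong) (auto simp: fe)
      thus ?thesis using i u by (simp add: fe)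
    qed
    ultimately show "\<exists>f. (\<exists>x\<in>T. f x \<noteq> 0) \<and> (\<forall>x\<in>T. (\<Sum>y\<in>T. of_real (W x y) * f y) = z * f x)"
      by blast
  next
    assume "\<exists>f. (\<exists>x\<in>T. f x \<noteq> 0) \<and> (\<forall>x\<in>T. (\<Sum>y\<in>T. of_real (W x y) * f y) = z * f x)"
    then obtain f x where x: "x \<in> T" "f x \<noteq> 0"
      and f: "\<And>x. x \<in> T \<Longrightarrow> (\<Sum>y\<in>T. of_real (W x y) * f y) = z * f x" by blast
    obtain i where i: "i < d" "x = e i" using e_ex[OF x(1)] by blast
    let ?u = "Matrix.vec d (\<lambda>i. f (e i))"
    have "vec_index ?u i \<noteq> vec_index (0\<^sub>v d) i" using x i by simp
    hence "?u \<noteq> 0\<^sub>v d" by metis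
    moreover have "A *\<^sub>v ?u = z \<cdot>\<^sub>v ?u"
    proof (rule eq_vecI)
      fix i assume "i < dim_vec (z \<cdot>\<^sub>v ?u)"
      hence i: "i < d" by simp
      have "vec_index (A *\<^sub>v ?u) i = (\<Sum>y\<in>T. of_real (W (e i) y) * f y)"
        unfolding re by (subst Av[OF i]) auto
      also have "\<dots> = z * f (e i)" by (rule f[OF e_in[OF i]])
      finally show "vec_index (A *\<^sub>v ?u) i = vec_index (z \<cdot>\<^sub>v ?u) i" using i by simp
    qed (simp add: A_def)
    ultimately show "eigenvalue A z"
      unfolding eigenvalue_def eigenvector_def by (intro exI[of _ ?u]) (auto simp: A_def)
  qed
qed

text \<open>The spectral radius is a supremum of reals, which is meaningful only for a nonempty set
  that is bounded above.\<close>

lemma op_spectrum_finite_nonempty: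
  fixes L :: "(real \<Rightarrow> real) \<Rightarrow> real \<Rightarrow> real"
  assumes fin: "finite T" and ne: "T \<noteq> {}"
    and kern: "has_kernel_on T W L"
  shows "finite (op_spectrum T L)" "op_spectrum T L \<noteq> {}"
proof -
  obtain e where e: "bij_betw e {..<card T} T"
    using ex_bij_betw_nat_finite[OF fin] by (auto simp: lessThan_atLeast0)
  define A where "A = Matrix.mat (card T) (card T) (\<lambda>(i, j). complex_of_real (W (e i) (e j)))"
  have A: "A \<in> carrier_mat (card T) (card T)" by (simp add: A_def)
  have "op_spectrum T L = spectrum A"
    using op_spectrum_finite[OF fin ne kern e] by (simp add: A_def spectrum_def)
  moreover have "card T > 0" using fin ne by (simp add: card_gt_0_iff)
  ultimately show "finite (op_spectrum T L)" "op_spectrum T L \<noteq> {}"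
    using card_finite_spectrum(1)[OF A] spectrum_non_empty[OF A] by auto
qed

text \<open>By the Jordan normal form the powers of a matrix with spectral radius below 1 have
  uniformly bounded entries. The inequality has to be strict: a Jordan block for an eigenvalue of
  modulus 1 can make the powers grow polynomially.\<close>

lemma kernel_op_powers_bounded:
  fixes L :: "(real \<Rightarrow> real) \<Rightarrow> real \<Rightarrow> real"
  assumes fin: "finite T" and ne: "T \<noteq> {}"
    and kern: "has_kernel_on T W L"
    and spec: "\<And>z. z \<in> op_spectrum T L \<Longrightarrow> norm z < 1"
  shows "\<exists>C. \<forall>k. \<forall>x\<in>T. \<bar>(L ^^ k) f x\<bar> \<le> C"
proof -
  note ker = has_kernel_onD[OF kern]
  obtain e where e: "bij_betw e {..<card T} T"
    using ex_bij_betw_nat_finite[OF fin] by (auto simp: lessThan_atLeast0)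
  define d where "d = card T"
  define A where "A = Matrix.mat d d (\<lambda>(i, j). complex_of_real (W (e i) (e j)))"
  have A: "A \<in> carrier_mat d d" by (simp add: A_def)
  have e: "bij_betw e {..<d} T" using e by (simp add: d_def)
  have d: "d > 0" using fin ne by (simp add: card_gt_0_iff d_def)
  have e_in: "e i \<in> T" if "i < d" for i using e that by (auto simp: bij_betw_def)
  have e_ex: "\<exists>i<d. x = e i" if "x \<in> T" for x using e that by (auto simp: bij_betw_def)
  have "op_spectrum T L = spectrum A"
    using op_spectrum_finite[OF fin ne kern e] by (simp add: A_def spectrum_def)
  hence "spectral_radius A < 1"
    using spectral_radius_mem_max(1)[OF A d] spec by auto
  then obtain c where c: "norm_bound (A ^\<^sub>m k) c" for k
    using spectral_radius_jnf_norm_bound_less_1_upper_triangular[OF A] by blast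
  define \<phi> where "\<phi> f = Matrix.vec d (\<lambda>i. complex_of_real (f (e i)))" for f :: "real \<Rightarrow> real"
  have \<phi>: "\<phi> f \<in> carrier_vec d" for f by (simp add: \<phi>_def)
  have step: "A *\<^sub>v \<phi> f = \<phi> (L f)" for f
  proof (rule eq_vecI)
    fix i assume "i < dim_vec (\<phi> (L f))"
    hence i: "i < d" by (simp add: \<phi>_def)
    have "L f (e i) = (\<Sum>j<d. W (e i) (e j) * f (e j))"
      unfolding ker[OF e_in[OF i]] by (rule sum.reindex_bij_betw[OF e, symmetric])
    thus "vec_index (A *\<^sub>v \<phi> f) i = vec_index (\<phi> (L f)) i"
      using i by (simp add: A_def \<phi>_def scalar_prod_def lessThan_atLeast0)
  qed (simp add: A_def \<phi>_def)
  have pow: "(A ^\<^sub>m k) *\<^sub>v \<phi> f = \<phi> ((L ^^ k) f)" for k f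
  proof (induction k arbitrary: f)
    case (Suc k)
    have "(A ^\<^sub>m Suc k) *\<^sub>v \<phi> f = (A ^\<^sub>m k) *\<^sub>v (A *\<^sub>v \<phi> f)"
      using assoc_mult_mat_vec[OF pow_carrier_mat[OF A] A \<phi>] by simp
    also have "\<dots> = \<phi> ((L ^^ k) (L f))" by (simp add: step Suc.IH)
    finally show ?case by (simp add: funpow_swap1)
  qed (use A \<phi> in auto)
  show ?thesis
  proof (intro exI allI ballI)
    fix k x assume "x \<in> T"
    then obtain i where i: "i < d" "x = e i" using e_ex by blast
    have Ak: "A ^\<^sub>m k \<in> carrier_mat d d" using A by simp
    have "complex_of_real ((L ^^ k) f x) = vec_index ((A ^\<^sub>m k) *\<^sub>v \<phi> f) i"
      using i by (simp add: pow) (simp add: \<phi>_def)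
    also have "\<dots> = (\<Sum>j<d. (A ^\<^sub>m k) $$ (i, j) * of_real (f (e j)))"
      using i carrier_matD[OF Ak] by (simp add: \<phi>_def scalar_prod_def lessThan_atLeast0)
    finally have "\<bar>(L ^^ k) f x\<bar> = norm (\<Sum>j<d. (A ^\<^sub>m k) $$ (i, j) * of_real (f (e j)))"
      by (metis norm_of_real real_norm_def)
    also have "\<dots> \<le> (\<Sum>j<d. c * \<bar>f (e j)\<bar>)"
      using c[of k] i carrier_matD[OF Ak]
      by (intro sum_norm_le) (auto simp: norm_mult norm_bound_def intro!: mult_right_mono)
    finally show "\<bar>(L ^^ k) f x\<bar> \<le> (\<Sum>j<d. c * \<bar>f (e j)\<bar>)" .
  qed
qed

text \<open>The real and imaginary parts of an eigenfunction f for z are iterated separately by the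
  real operator and reassemble to z^k f. Growth bounds for real functions therefore bound |z|^k, and
  |z| > \<rho> would contradict them for large k.\<close>

lemma op_spectral_radius_le_if_power_growth_le:
  fixes L :: "(real \<Rightarrow> real) \<Rightarrow> real \<Rightarrow> real"
  assumes fin: "finite T" and ne: "T \<noteq> {}"
    and kern: "has_kernel_on T W L"
    and "\<rho> > 0"
    and growth: "\<And>f. \<exists>C. \<forall>k. \<forall>x\<in>T. \<bar>(L ^^ k) f x\<bar> \<le> C * \<rho> ^ k"
  shows "op_spectral_radius T L \<le> \<rho>"
  unfolding op_spectral_radius_def
proof (rule cSUP_least)
  note ker = has_kernel_onD[OF kern]
  show "op_spectrum T L \<noteq> {}" by (rule op_spectrum_finite_nonempty(2)[OF fin ne kern])
  fix z assume "z \<in> op_spectrum T L"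
  then obtain f x where x: "x \<in> T" "f x \<noteq> 0"
    and f: "\<And>x. x \<in> T \<Longrightarrow> (\<Sum>y\<in>T. of_real (W x y) * f y) = z * f x"
    unfolding op_spectrum_finite_iff_eigenfunction[OF fin ne kern] by blast
  let ?p = "\<lambda>k. (L ^^ k) (\<lambda>x. Re (f x))" and ?q = "\<lambda>k. (L ^^ k) (\<lambda>x. Im (f x))"
  have it: "Complex (?p k y) (?q k y) = z ^ k * f y" if "y \<in> T" for k y
    using that
  proof (induction k arbitrary: y)
    case (Suc k)
    have "Complex (?p (Suc k) y) (?q (Suc k) y)
        = (\<Sum>u\<in>T. of_real (W y u) * Complex (?p k u) (?q k u))"
      by (simp add: ker[OF Suc.prems] complex_eq_iff)
    also have "\<dots> = z ^ k * (\<Sum>u\<in>T. of_real (W y u) * f u)"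
      by (simp add: Suc.IH sum_distrib_left mult.left_commute cong: sum.cong)
    finally show ?case by (simp add: f[OF Suc.prems])
  qed simp
  obtain C where C: "\<And>k y. y \<in> T \<Longrightarrow> \<bar>?p k y\<bar> \<le> C * \<rho> ^ k" using growth by blast
  obtain C' where C': "\<And>k y. y \<in> T \<Longrightarrow> \<bar>?q k y\<bar> \<le> C' * \<rho> ^ k" using growth by blast
  have bd: "norm z ^ k * norm (f x) \<le> (C + C') * \<rho> ^ k" for k
  proof -
    have "norm z ^ k * norm (f x) = norm (Complex (?p k x) (?q k x))"
      by (simp add: it[OF x(1)] norm_mult norm_power)
    also have "\<dots> \<le> \<bar>?p k x\<bar> + \<bar>?q k x\<bar>"
      using cmod_le[of "Complex (?p k x) (?q k x)"] by simp
    also have "\<dots> \<le> (C + C') * \<rho> ^ k" using C[OF x(1), of k] C'[OF x(1), of k] by (simp add: algebra_simps)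
    finally show ?thesis .
  qed
  show "norm z \<le> \<rho>"
  proof (rule ccontr)
    assume "\<not> norm z \<le> \<rho>"
    hence "norm z / \<rho> > 1" using \<open>\<rho> > 0\<close> by simp
    then obtain k where k: "(norm z / \<rho>) ^ k > (C + C') / norm (f x)" using real_arch_pow by blast
    from bd[of k] have "(norm z / \<rho>) ^ k * norm (f x) \<le> C + C'"
      using \<open>\<rho> > 0\<close> by (simp add: power_divide field_simps)
    with k x(2) show False by (simp add: field_simps)
  qed
qed

text \<open>Otherwise \<open>L\<close> is divided by some \<tau> strictly between the spectral
  radius and \<sigma>. The rescaled operator has bounded powers, yet its iterates of
  \<open>w\<close> at \<open>x\<close> grow at least like (\<sigma>/\<tau>)^k.\<close>

lemma op_spectral_radius_ge_if_power_growth_ge: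
  fixes L :: "(real \<Rightarrow> real) \<Rightarrow> real \<Rightarrow> real"
  assumes fin: "finite T"
    and kern: "has_kernel_on T W L"
    and "\<sigma> > 0" and x: "x \<in> T" and "w x > 0"
    and growth: "\<And>k. \<sigma> ^ k * w x \<le> (L ^^ k) w x"
  shows "\<sigma> \<le> op_spectral_radius T L"
proof (rule ccontr)
  note ker = has_kernel_onD[OF kern]
  have ne: "T \<noteq> {}" using x by auto
  note sp = op_spectrum_finite_nonempty[OF fin ne kern]
  assume "\<not> \<sigma> \<le> op_spectral_radius T L"
  then obtain \<tau>0 where \<tau>0: "op_spectral_radius T L < \<tau>0" "\<tau>0 < \<sigma>" using dense by (metis not_le)
  \<comment> \<open>The maximum with \<sigma>/2 makes \<tau> positive without a separate argument
    about the sign of the spectral radius.\<close>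
  define \<tau> where "\<tau> = max \<tau>0 (\<sigma> / 2)"
  have \<tau>: "op_spectral_radius T L < \<tau>" "\<tau> < \<sigma>" "\<tau> > 0" using \<tau>0 \<open>\<sigma> > 0\<close> by (auto simp: \<tau>_def)
  define L' where "L' f x = L f x / \<tau>" for f x
  have kern': "has_kernel_on T (\<lambda>x y. W x y / \<tau>) L'"
    by (simp add: has_kernel_on_def L'_def ker sum_divide_distrib)
  have ker': "L' f x = (\<Sum>y\<in>T. (W x y / \<tau>) * f y)" if "x \<in> T" for f x
    by (simp add: L'_def ker[OF that] sum_divide_distrib)
  have "norm z < 1" if z: "z \<in> op_spectrum T L'" for z
  proof -
    obtain f y where y: "y \<in> T" "f y \<noteq> 0"
      and f: "\<And>x. x \<in> T \<Longrightarrow> (\<Sum>y\<in>T. of_real (W x y / \<tau>) * f y) = z * f x"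
      using z unfolding op_spectrum_finite_iff_eigenfunction[OF fin ne kern'] by blast
    have "(\<Sum>y\<in>T. of_real (W x y) * f y) = (of_real \<tau> * z) * f x" if "x \<in> T" for x
    proof -
      have "(\<Sum>y\<in>T. of_real (W x y) * f y) = of_real \<tau> * (\<Sum>y\<in>T. of_real (W x y / \<tau>) * f y)"
        using \<tau> by (simp add: sum_distrib_left)
      thus ?thesis by (simp only: f[OF that] mult.assoc)
    qed
    hence "of_real \<tau> * z \<in> op_spectrum T L"
      using y unfolding op_spectrum_finite_iff_eigenfunction[OF fin ne kern] by blast
    hence "norm (of_real \<tau> * z) \<le> op_spectral_radius T L"
      unfolding op_spectral_radius_def using sp by (intro cSUP_upper bdd_above_finite) auto
    hence "\<tau> * norm z \<le> op_spectral_radius T L" using \<tau> by (simp add: norm_mult)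
    hence "\<tau> * norm z < \<tau> * 1" using \<tau>(1) by linarith
    thus ?thesis using \<tau> by (simp only: mult_less_cancel_left_pos)
  qed
  from kernel_op_powers_bounded[OF fin ne kern' this]
  obtain C where C: "\<And>k y. y \<in> T \<Longrightarrow> \<bar>(L' ^^ k) w y\<bar> \<le> C" by blast
  have L'L: "(L' ^^ k) w y = (L ^^ k) w y / \<tau> ^ k" if "y \<in> T" for k y
    using that
  proof (induction k arbitrary: y)
    case (Suc k)
    have "(L' ^^ Suc k) w y = (\<Sum>u\<in>T. (W y u / \<tau>) * ((L ^^ k) w u / \<tau> ^ k))"
      by (simp add: ker'[OF Suc.prems] Suc.IH cong: sum.cong)
    also have "\<dots> = (\<Sum>u\<in>T. W y u * (L ^^ k) w u) / \<tau> ^ Suc k"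
      by (simp add: sum_divide_distrib)
    finally show ?case by (simp add: ker[OF Suc.prems])
  qed simp
  have "\<sigma> / \<tau> > 1" using \<tau> by simp
  then obtain k where k: "(\<sigma> / \<tau>) ^ k > C / w x" using real_arch_pow by blast
  have "(\<sigma> / \<tau>) ^ k * w x \<le> (L' ^^ k) w x"
    unfolding L'L[OF x] power_divide using growth[of k] \<tau> by (simp add: divide_right_mono)
  also have "\<dots> \<le> C" using C[OF x, of k] by simp
  finally show False using k \<open>w x > 0\<close> by (simp add: field_simps)
qed

text \<open>The Collatz--Wielandt bounds, for the partial order of a cone \<open>K\<close> that need not contain
  all nonnegative functions.\<close>

lemma op_spectral_radius_cone_bounds:
  fixes L :: "(real \<Rightarrow> real) \<Rightarrow> real \<Rightarrow> real"
  assumes fin: "finite T" and ne: "T \<noteq> {}"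
    and kern: "has_kernel_on T W L"
    and K_cong: "\<And>f g. f \<in> K \<Longrightarrow> (\<And>x. x \<in> T \<Longrightarrow> g x = f x) \<Longrightarrow> g \<in> K"
    and K_add: "\<And>f g. f \<in> K \<Longrightarrow> g \<in> K \<Longrightarrow> (\<lambda>x. f x + g x) \<in> K"
    and K_scale: "\<And>c f. c \<ge> 0 \<Longrightarrow> f \<in> K \<Longrightarrow> (\<lambda>x. c * f x) \<in> K"
    and K_nonneg: "\<And>f x. f \<in> K \<Longrightarrow> x \<in> T \<Longrightarrow> f x \<ge> 0"
    and LK: "\<And>f. f \<in> K \<Longrightarrow> L f \<in> K"
    and unit: "\<And>f. \<exists>C\<ge>0. (\<lambda>x. C * w x + f x) \<in> K"
    and w_pos: "\<And>x. x \<in> T \<Longrightarrow> w x > 0"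
    and "\<sigma> > 0" and "\<rho> > 0"
    and lower: "(\<lambda>x. L w x - \<sigma> * w x) \<in> K"
    and upper: "(\<lambda>x. \<rho> * w x - L w x) \<in> K"
  shows "\<sigma> \<le> op_spectral_radius T L \<and> op_spectral_radius T L \<le> \<rho>"
proof
  note ker = has_kernel_onD[OF kern]
  have lin: "(L ^^ k) (\<lambda>x. c * f x + c' * g x) x = c * (L ^^ k) f x + c' * (L ^^ k) g x"
    if "x \<in> T" for c c' f g x k
    using that
  proof (induction k arbitrary: x)
    case (Suc k)
    thus ?case by (simp add: ker sum_distrib_left sum.distrib algebra_simps cong: sum.cong)
  qed simp
  have LkK: "(L ^^ k) f \<in> K" if "f \<in> K" for f k
    using that by (induction k) (auto intro: LK)
  have K0: "(\<lambda>x. 0) \<in> K" using K_scale[OF order_refl upper] by simp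
  \<comment> \<open>Telescoping: L^(k+1) w - \<sigma>^(k+1) w = L (L^k w - \<sigma>^k w) +
    \<sigma>^k (L w - \<sigma> w), a sum of two elements of the cone. The upper estimate
    \<open>upp\<close> is obtained in the same way.\<close>
  have low: "(\<lambda>x. (L ^^ k) w x - \<sigma> ^ k * w x) \<in> K" for k
  proof (induction k)
    case (Suc k)
    have "(\<lambda>x. L (\<lambda>x. (L ^^ k) w x - \<sigma> ^ k * w x) x + \<sigma> ^ k * (L w x - \<sigma> * w x)) \<in> K"
      using Suc lower \<open>\<sigma> > 0\<close> by (intro K_add LK K_scale) auto
    thus ?case
      by (rule K_cong) (simp add: ker sum_subtractf sum_distrib_left algebra_simps)
  qed (simp add: K0)
  have upp: "(\<lambda>x. \<rho> ^ k * w x - (L ^^ k) w x) \<in> K" for k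
  proof (induction k)
    case (Suc k)
    have "(\<lambda>x. L (\<lambda>x. \<rho> ^ k * w x - (L ^^ k) w x) x + \<rho> ^ k * (\<rho> * w x - L w x)) \<in> K"
      using Suc upper \<open>\<rho> > 0\<close> by (intro K_add LK K_scale) auto
    thus ?case
      by (rule K_cong) (simp add: ker sum_subtractf sum_distrib_left algebra_simps)
  qed (simp add: K0)
  obtain x where x: "x \<in> T" using ne by blast
  show "\<sigma> \<le> op_spectral_radius T L"
    by (rule op_spectral_radius_ge_if_power_growth_ge[where w = w, OF fin kern \<open>\<sigma> > 0\<close> x w_pos[OF x]])
      (use K_nonneg[OF low x] in auto)
  have "\<exists>C. \<forall>k. \<forall>x\<in>T. \<bar>(L ^^ k) f x\<bar> \<le> C * \<rho> ^ k" for f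
  proof -
    \<comment> \<open>In the order of the cone f lies between - C1 w and C2 w. Invariance passes
      this on to the iterates, and only then does nonnegativity of cone elements turn it into a
      pointwise bound by L^k w, hence by \<rho>^k w.\<close>
    obtain C1 where C1: "C1 \<ge> 0" "(\<lambda>x. C1 * w x + f x) \<in> K" using unit by blast
    obtain C2 where C2: "C2 \<ge> 0" "(\<lambda>x. C2 * w x + - f x) \<in> K" using unit[of "\<lambda>x. - f x"] by blast
    have "\<bar>(L ^^ k) f x\<bar> \<le> ((C1 + C2) * Max (w ` T)) * \<rho> ^ k" if x: "x \<in> T" for k x
    proof -
      let ?u = "(L ^^ k) w x" and ?f = "(L ^^ k) f x"
      have f1: "C1 * ?u + ?f \<ge> 0"
        using K_nonneg[OF LkK[OF C1(2)] x, of k] lin[OF x, of k C1 w 1 f] by simp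
      have f2: "C2 * ?u - ?f \<ge> 0"
        using K_nonneg[OF LkK[OF C2(2)] x, of k] lin[OF x, of k C2 w "-1" f] by simp
      have u: "?u \<le> \<rho> ^ k * w x" using K_nonneg[OF upp x, of k] by simp
      \<comment> \<open>Positivity of \<open>w\<close> alone would not give this, as the matrix may
        have negative entries; the cone inequality L^k w \<ge> \<sigma>^k w does.\<close>
      have u0: "0 \<le> ?u"
        using K_nonneg[OF low x, of k] mult_pos_pos[OF zero_less_power[OF \<open>\<sigma> > 0\<close>] w_pos[OF x], of k]
        by linarith
      have "\<bar>?f\<bar> \<le> (C1 + C2) * ?u"
        using f1 f2 mult_nonneg_nonneg[OF C1(1) u0] mult_nonneg_nonneg[OF C2(1) u0]
        by (auto simp: algebra_simps abs_le_iff)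
      also have "\<dots> \<le> (C1 + C2) * (\<rho> ^ k * Max (w ` T))"
      proof (rule mult_left_mono)
        have "w x \<le> Max (w ` T)" using fin x by simp
        thus "?u \<le> \<rho> ^ k * Max (w ` T)"
          using u \<open>\<rho> > 0\<close> by (meson mult_left_mono order_trans zero_le_power less_imp_le)
      qed (use C1 C2 in auto)
      finally show ?thesis by (simp add: mult_ac)
    qed
    thus ?thesis by blast
  qed
  thus "op_spectral_radius T L \<le> \<rho>"
    by (rule op_spectral_radius_le_if_power_growth_le[OF fin ne kern \<open>\<rho> > 0\<close>])
qed

section \<open>Interpolation error and Chebyshev points\<close>

text \<open>Successive derivatives are passed as a family \<open>D\<close>, differentiable only in
  the open interval and merely continuous up to the ends, so one-sided derivatives never enter. Each
  use of Rolle's theorem costs one of the n + 1 zeros; for n = 0 the point found is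
  \<open>z 0\<close> itself, which may be an end point.\<close>

lemma iterated_Rolle:
  fixes D :: "nat \<Rightarrow> real \<Rightarrow> real"
  assumes "\<And>k. k < n \<Longrightarrow> continuous_on {c..d} (D k)"
    and "\<And>k x. k < n \<Longrightarrow> c < x \<Longrightarrow> x < d \<Longrightarrow> (D k has_real_derivative D (Suc k) x) (at x)"
    and "\<And>i. i \<le> n \<Longrightarrow> z i \<in> {c..d}"
    and "\<And>i. i < n \<Longrightarrow> z i < z (Suc i)"
    and "\<And>i. i \<le> n \<Longrightarrow> D 0 (z i) = 0"
  shows "\<exists>x\<in>{c..d}. D n x = 0"
  using assms
proof (induction n arbitrary: D z)
  case (Suc n)
  have "\<exists>y. z i < y \<and> y < z (Suc i) \<and> D 1 y = 0" if i: "i \<le> n" for i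
  proof -
    have ci: "c \<le> z i" "z (Suc i) \<le> d" using Suc.prems(3)[of i] Suc.prems(3)[of "Suc i"] i by auto
    have der: "(D 0 has_real_derivative D 1 x) (at x)" if "z i < x" "x < z (Suc i)" for x
      using Suc.prems(2)[of 0 x] that ci by simp
    have "\<exists>y. z i < y \<and> y < z (Suc i) \<and> (D 0 has_real_derivative 0) (at y)"
    proof (rule Rolle)
      show "z i < z (Suc i)" using Suc.prems(4)[of i] i by simp
      show "D 0 (z i) = D 0 (z (Suc i))" using Suc.prems(5)[of i] Suc.prems(5)[of "Suc i"] i by simp
      show "continuous_on {z i..z (Suc i)} (D 0)"
        by (rule continuous_on_subset[OF Suc.prems(1)[of 0]]) (use ci in auto)
      show "D 0 differentiable at x" if "z i < x" "x < z (Suc i)" for x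
        using der[OF that] real_differentiable_def by blast
    qed
    thus ?thesis using der DERIV_unique by blast
  qed
  then obtain y where y: "\<And>i. i \<le> n \<Longrightarrow> z i < y i \<and> y i < z (Suc i) \<and> D 1 (y i) = 0" by metis
  have "\<exists>x\<in>{c..d}. D (Suc n) x = 0"
  proof (rule Suc.IH[of "\<lambda>k. D (Suc k)" y])
    fix i assume i: "i \<le> n"
    show "y i \<in> {c..d}"
      using y[OF i] Suc.prems(3)[of i] Suc.prems(3)[of "Suc i"] i by auto
  next
    fix i assume "i < n"
    thus "y i < y (Suc i)" using y[of i] y[of "Suc i"] by auto
  qed (use Suc.prems y in auto)
  thus ?case .
qed auto

lemma C_class_on_has_real_derivative:
  assumes "C_class_on m {a..b} f" "k < m" "a < x" "x < b"
  shows "(nth_deriv_within {a..b} k f has_real_derivative nth_deriv_within {a..b} (Suc k) f x) (at x)"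
proof -
  have "nth_deriv_within {a..b} k f differentiable (at x within {a..b})"
    using assms by (auto simp: C_class_on_def)
  hence "(nth_deriv_within {a..b} k f has_vector_derivative nth_deriv_within {a..b} (Suc k) f x)
      (at x within {a..b})"
    by (simp add: vector_derivative_works)
  thus ?thesis
    using assms(3,4) by (simp add: at_within_Icc_at has_real_derivative_iff_has_vector_derivative del: nth_deriv_within.simps)
qed

lemma C_class_on_continuous_on:
  assumes "C_class_on m S f" "k \<le> m"
  shows "continuous_on S (nth_deriv_within S k f)"
proof (cases "k = m")
  case False
  with assms show ?thesis
    by (auto simp: C_class_on_def continuous_on_eq_continuous_within
        intro!: differentiable_imp_continuous_within)
qed (use assms in \<open>simp add: C_class_on_def\<close>)

lemma higher_pderiv_eq_const:
  fixes p :: "real poly"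
  assumes "degree p \<le> n"
  shows "(pderiv ^^ n) p = [:fact n * coeff p n:]"
proof (rule poly_eqI)
  fix i
  have "coeff p (i + n) = 0" if "i > 0" using assms that by (intro coeff_eq_0) simp
  thus "coeff ((pderiv ^^ n) p) i = coeff [:fact n * coeff p n:] i"
    by (cases i) (auto simp: coeff_higher_pderiv pochhammer_fact)
qed

lemma monic_node_poly:
  fixes X :: "'a :: idom set"
  assumes "finite X"
  shows "degree (\<Prod>y\<in>X. [:- y, 1:]) = card X" "coeff (\<Prod>y\<in>X. [:- y, 1:]) (card X) = 1"
proof -
  show deg: "degree (\<Prod>y\<in>X. [:- y, 1:]) = card X" by (subst degree_prod_sum_eq) auto
  show "coeff (\<Prod>y\<in>X. [:- y, 1:]) (card X) = 1"
    unfolding deg[symmetric] lead_coeff_prod by simp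
qed

text \<open>Cauchy's remainder formula. A multiple of the node polynomial is added to
  \<open>P\<close> so that f - Q vanishes at x as well as at the nodes; these r + 2 zeros force a
  zero of the derivative of order r + 1.\<close>

lemma interpolation_error:
  fixes f :: "real \<Rightarrow> real"
  assumes C: "C_class_on m {a..b} f" and m: "Suc r \<le> m"
    and sub: "{c..d} \<subseteq> {a..b}"
    and X: "finite X" "X \<subseteq> {c..d}" "card X = Suc r"
    and P: "degree P \<le> r" "\<And>y. y \<in> X \<Longrightarrow> poly P y = f y"
    and x: "x \<in> {c..d}"
  shows "\<exists>\<xi>\<in>{c..d}. f x - poly P x =
           nth_deriv_within {a..b} (Suc r) f \<xi> / fact (Suc r) * (\<Prod>y\<in>X. x - y)"
proof (cases "x \<in> X")
  case True
  hence "(\<Prod>y\<in>X. x - y) = 0" using X(1) by auto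
  thus ?thesis using x P(2)[OF True] by (intro bexI[of _ x]) auto
next
  case False
  define w where "w = (\<Prod>y\<in>X. [:- y, 1:])"
  have w: "poly w t = (\<Prod>y\<in>X. t - y)" for t by (simp add: w_def poly_prod)
  have wx: "poly w x \<noteq> 0" using False X(1) by (auto simp: w)
  \<comment> \<open>With this value \<open>Q\<close> interpolates f at x too. It is also the
    coefficient of \<open>Q\<close> at degree r + 1, since the node polynomial is monic of that
    degree and \<open>P\<close> has degree at most r.\<close>
  define K where "K = (f x - poly P x) / poly w x"
  define Q where "Q = P + Polynomial.smult K w"
  have degQ: "degree Q \<le> Suc r"
    unfolding Q_def using P(1) monic_node_poly(1)[OF X(1)] X(3)
    by (intro degree_add_le) (auto simp: w_def intro!: order.trans[OF degree_smult_le])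
  have coeffQ: "coeff Q (Suc r) = K"
    using coeff_eq_0[of P "Suc r"] P(1) monic_node_poly(2)[OF X(1)] X(3) by (simp add: Q_def w_def)
  define D where "D k t = nth_deriv_within {a..b} k f t - poly ((pderiv ^^ k) Q) t" for k t
  define zs where "zs = sorted_list_of_set (insert x X)"
  have len: "length zs = Suc (Suc r)" using X False by (simp add: zs_def del: sorted_list_of_set_insert_remove)
  have set: "set zs = insert x X" using X(1) by (simp add: zs_def del: sorted_list_of_set_insert_remove)
  have sor: "sorted_wrt (<) zs" unfolding zs_def by (rule strict_sorted_list_of_set)
  have "\<exists>\<xi>\<in>{c..d}. D (Suc r) \<xi> = 0"
  proof (rule iterated_Rolle[of "Suc r" c d D "\<lambda>i. zs ! i"])
    fix k assume k: "k < Suc r"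
    show "continuous_on {c..d} (D k)" unfolding D_def
      by (intro continuous_intros continuous_on_subset[OF C_class_on_continuous_on[OF C] sub])
        (use k m in auto)
    fix t assume t: "c < t" "t < d"
    have "a \<le> c" "d \<le> b" using t sub by (auto simp: atLeastatMost_subset_iff)
    hence "a < t" "t < b" using t by auto
    thus "(D k has_real_derivative D (Suc k) t) (at t)"
      unfolding D_def using k m
      by (auto intro!: derivative_eq_intros C_class_on_has_real_derivative[OF C] poly_DERIV
          simp del: nth_deriv_within.simps)
  next
    fix i assume "i \<le> Suc r"
    hence i: "zs ! i \<in> insert x X" using len set nth_mem[of i zs] by auto
    thus "zs ! i \<in> {c..d}" using x X(2) by auto
    show "D 0 (zs ! i) = 0"
    proof (cases "zs ! i = x")
      case True
      thus ?thesis using wx by (simp add: D_def Q_def K_def)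
    next
      case False
      hence "zs ! i \<in> X" using i by auto
      moreover have "poly w (zs ! i) = 0" using calculation X(1) by (auto simp: w)
      ultimately show ?thesis using P(2) by (simp add: D_def Q_def)
    qed
  next
    fix i assume "i < Suc r"
    thus "zs ! i < zs ! Suc i" using sorted_wrt_nth_less[OF sor, of i "Suc i"] len by simp
  qed
  then obtain \<xi> where \<xi>: "\<xi> \<in> {c..d}" "D (Suc r) \<xi> = 0" by blast
  have "nth_deriv_within {a..b} (Suc r) f \<xi> = fact (Suc r) * K"
    using \<xi>(2) unfolding D_def higher_pderiv_eq_const[OF degQ] coeffQ by simp
  hence "nth_deriv_within {a..b} (Suc r) f \<xi> / fact (Suc r) * poly w x = f x - poly P x"
    using wx by (simp add: K_def del: nth_deriv_within.simps fact_Suc)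
  thus ?thesis using \<xi>(1) w by (intro bexI[of _ \<xi>]) auto
qed

text \<open>The explicit formula is recorded because its weights do not depend on \<open>F\<close>:
  at a fixed point they become the row of a matrix.\<close>

lemma lagrange_interpolation:
  fixes X :: "real set"
  assumes X: "finite X" "card X = Suc r"
  shows "\<exists>P. degree P \<le> r \<and> (\<forall>y\<in>X. poly P y = F y) \<and>
    (\<forall>x. poly P x = (\<Sum>y\<in>X. (\<Prod>z\<in>X - {y}. (x - z) / (y - z)) * F y))"
proof -
  define P where "P = (\<Sum>y\<in>X. Polynomial.smult (F y / (\<Prod>z\<in>X - {y}. y - z)) (\<Prod>z\<in>X - {y}. [:- z, 1:]))"
  have "degree P \<le> r" unfolding P_def
  proof (rule degree_sum_le[OF X(1)])
    fix y assume "y \<in> X"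
    hence "card (X - {y}) = r" using X by simp
    thus "degree (Polynomial.smult (F y / (\<Prod>z\<in>X - {y}. y - z)) (\<Prod>z\<in>X - {y}. [:- z, 1:])) \<le> r"
      using monic_node_poly(1)[of "X - {y}"] X(1) by (intro order.trans[OF degree_smult_le]) auto
  qed
  moreover have val: "poly P x = (\<Sum>y\<in>X. (\<Prod>z\<in>X - {y}. (x - z) / (y - z)) * F y)" for x
    by (simp add: P_def poly_sum poly_prod prod_dividef mult_ac)
  moreover have "poly P x = F x" if x: "x \<in> X" for x
  proof -
    have "(\<Prod>z\<in>X - {y}. (x - z) / (y - z)) * F y = (if y = x then F x else 0)" if "y \<in> X" for y
    proof (cases "y = x")
      case True
      have "(\<Prod>z\<in>X - {x}. (x - z) / (x - z)) = 1" by (intro prod.neutral) auto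
      with True show ?thesis by simp
    next
      case False
      hence "(\<Prod>z\<in>X - {y}. (x - z) / (y - z)) = 0"
        using X(1) x by (intro prod_zero) (auto intro!: bexI[of _ x])
      with False show ?thesis by simp
    qed
    thus ?thesis unfolding val using X(1) x by simp
  qed
  ultimately show ?thesis by blast
qed

text \<open>These are the Chebyshev polynomials of the first kind; the index is shifted by one so
  that the leading coefficient is 2^n without an exceptional case for degree 0.\<close>

lemma chebyshev_poly_exists:
  "\<exists>p :: real poly. degree p \<le> Suc n \<and> coeff p (Suc n) = 2 ^ n \<and>
     (\<forall>x. poly p (cos x) = cos (real (Suc n) * x))"
proof (induction n rule: induct_nat_012)
  case 0
  show ?case by (intro exI[of _ "[:0, 1:]"]) auto
next
  case 1
  show ?case
    by (intro exI[of _ "[:-1, 0, 2:]"]) (auto simp: cos_double_cos power2_eq_square)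
next
  case (ge2 n)
  obtain p q :: "real poly" where p: "degree p \<le> Suc n" "\<forall>x. poly p (cos x) = cos (real (Suc n) * x)"
    and q: "degree q \<le> Suc (Suc n)" "coeff q (Suc (Suc n)) = 2 ^ Suc n"
      "\<forall>x. poly q (cos x) = cos (real (Suc (Suc n)) * x)"
    using ge2 by blast
  \<comment> \<open>The three-term recurrence 2 X q - p, which reflects cos (t + x) + cos (t - x) =
    2 cos t cos x.\<close>
  let ?P = "pCons 0 (Polynomial.smult 2 q) - p"
  have "degree ?P \<le> Suc (Suc (Suc n))"
    using p q by (intro degree_diff_le) (auto intro: order.trans[OF degree_pCons_le])
  moreover have "coeff ?P (Suc (Suc (Suc n))) = 2 ^ Suc (Suc n)"
    using p q coeff_eq_0[of p "Suc (Suc (Suc n))"] by simp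
  moreover have "poly ?P (cos x) = cos (real (Suc (Suc (Suc n))) * x)" for x
  proof -
    define t where "t = real (Suc (Suc n)) * x"
    have "cos (real (Suc (Suc (Suc n))) * x) = cos (t + x)" "cos (real (Suc n) * x) = cos (t - x)"
      by (simp_all add: t_def algebra_simps)
    thus ?thesis using p(2) q(3) by (simp add: t_def[symmetric] cos_add cos_diff del: of_nat_Suc)
  qed
  ultimately show ?case by blast
qed

lemma cheb_zeros_strict_mono:
  assumes "k < k'" "k' \<le> r"
  shows "cos ((2 * real k + 1) / (2 * real r + 2) * pi) > cos ((2 * real k' + 1) / (2 * real r + 2) * pi)"
proof (rule cos_monotone_0_pi)
  show "0 \<le> (2 * real k + 1) / (2 * real r + 2) * pi" by simp
  show "(2 * real k + 1) / (2 * real r + 2) * pi < (2 * real k' + 1) / (2 * real r + 2) * pi"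
    using assms by (intro mult_strict_right_mono divide_strict_right_mono) auto
  have "(2 * real k' + 1) / (2 * real r + 2) \<le> 1" using assms by simp
  thus "(2 * real k' + 1) / (2 * real r + 2) * pi \<le> pi"
    using mult_right_mono[of "(2 * real k' + 1) / (2 * real r + 2)" 1 pi] by simp
qed

text \<open>The product is the Chebyshev polynomial of degree r + 1 at u divided by its leading
  coefficient 2^r, and that polynomial is bounded by 1 on [-1, 1].\<close>

lemma chebyshev_node_prod_bound:
  assumes "\<bar>u\<bar> \<le> 1"
  shows "\<bar>\<Prod>k\<le>r. u + cos ((2 * real k + 1) / (2 * real r + 2) * pi)\<bar> \<le> 1 / 2 ^ r"
proof -
  define x where "x k = - cos ((2 * real k + 1) / (2 * real r + 2) * pi)" for k
  obtain p :: "real poly" where p: "degree p \<le> Suc r" "coeff p (Suc r) = 2 ^ r"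
      "\<And>x. poly p (cos x) = cos (real (Suc r) * x)"
    using chebyshev_poly_exists by blast
  have inj: "inj_on x {..r}"
  proof (rule inj_onI)
    fix k k' assume "k \<in> {..r}" "k' \<in> {..r}" "x k = x k'"
    thus "k = k'"
      using cheb_zeros_strict_mono[of k k' r] cheb_zeros_strict_mono[of k' k r]
      by (cases k k' rule: linorder_cases) (auto simp: x_def)
  qed
  define X where "X = x ` {..r}"
  have X: "finite X" "card X = Suc r" using inj by (auto simp: X_def card_image)
  \<comment> \<open>The minus sign in \<open>x k\<close> replaces the angle \<phi> by \<pi> -
    \<phi>, which still yields a zero since the zeros lie symmetrically about 0.\<close>
  have root: "poly p (x k) = 0" for k
  proof -
    define \<phi> where "\<phi> = (2 * real k + 1) / (2 * real r + 2) * pi"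
    have r\<phi>: "real (Suc r) * \<phi> = real k * pi + pi / 2"
      by (simp add: \<phi>_def field_simps)
    have "x k = cos (pi - \<phi>)" by (simp add: x_def \<phi>_def)
    hence "poly p (x k) = cos (real (Suc r) * (pi - \<phi>))" by (simp only: p(3))
    also have "real (Suc r) * (pi - \<phi>) = real (Suc r) * pi - (real k * pi + pi / 2)"
      by (simp only: r\<phi> right_diff_distrib)
    also have "cos \<dots> = 0" by (simp only: cos_diff sin_npi cos_add sin_add cos_pi_half) simp
    finally show ?thesis .
  qed
  \<comment> \<open>Both sides have the same coefficient at degree r + 1, so their difference has
    degree at most r, and it vanishes at the r + 1 points of \<open>X\<close>.\<close>
  have pq: "p = Polynomial.smult (2 ^ r) (\<Prod>y\<in>X. [:- y, 1:])"
  proof (rule poly_eqI_degree_lead_coeff[where n = "Suc r" and A = X])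
    show "coeff p (Suc r) = coeff (Polynomial.smult (2 ^ r) (\<Prod>y\<in>X. [:- y, 1:])) (Suc r)"
      using monic_node_poly(2)[OF X(1)] X(2) p(2) by simp
    show "degree (Polynomial.smult (2 ^ r) (\<Prod>y\<in>X. [:- y, 1:])) \<le> Suc r"
      using monic_node_poly(1)[OF X(1)] X(2) by simp
    fix z assume z: "z \<in> X"
    have "(\<Prod>y\<in>X. z - y) = 0" using z X(1) by (intro prod_zero) auto
    thus "poly p z = poly (Polynomial.smult (2 ^ r) (\<Prod>y\<in>X. [:- y, 1:])) z"
      using z root by (auto simp: X_def poly_prod)
  qed (use X p in auto)
  have "(\<Prod>k\<le>r. u + cos ((2 * real k + 1) / (2 * real r + 2) * pi)) = (\<Prod>y\<in>X. u - y)"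
    unfolding X_def prod.reindex[OF inj] by (simp add: x_def)
  also have "\<dots> = poly p u / 2 ^ r" by (simp add: pq poly_prod)
  finally have eq: "(\<Prod>k\<le>r. u + cos ((2 * real k + 1) / (2 * real r + 2) * pi)) = poly p u / 2 ^ r" .
  have "poly p u = cos (real (Suc r) * arccos u)"
    using p(3)[of "arccos u"] assms by (simp add: cos_arccos_abs)
  hence "\<bar>poly p u\<bar> \<le> 1" by simp
  thus ?thesis unfolding eq abs_divide by (simp add: divide_right_mono)
qed

lemma sin_ge_sin_if_between:
  assumes "0 \<le> \<beta>" "\<beta> \<le> x" "x \<le> pi - \<beta>"
  shows "sin \<beta> \<le> sin x"
proof (cases "x \<le> pi / 2")
  case True
  thus ?thesis using assms by (intro sin_monotone_2pi_le) auto
next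
  case False
  have "sin \<beta> \<le> sin (pi - x)" using assms False by (intro sin_monotone_2pi_le) auto
  thus ?thesis by simp
qed

text \<open>All follow from 0 < \<alpha> \<le> \<pi>/4, that is, from r \<ge> 1. The last bound is
  cos (2\<alpha>) \<ge> 0; it says that the minimal node distance does not exceed the length of the
  subinterval.\<close>

lemma cheb_angle:
  assumes "r \<ge> 1"
  shows "0 < pi / (2 * real r + 2)" "pi / (2 * real r + 2) \<le> pi / 4"
    "0 < cos (pi / (2 * real r + 2))" "0 < sin (pi / (2 * real r + 2))"
    "2 * (sin (pi / (2 * real r + 2)))\<^sup>2 \<le> 1"
proof -
  let ?\<alpha> = "pi / (2 * real r + 2)"
  show 1: "0 < ?\<alpha>" by simp
  show 2: "?\<alpha> \<le> pi / 4" using assms by (intro divide_left_mono) auto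
  show "0 < cos ?\<alpha>" using 1 2 pi_gt_zero by (intro cos_gt_zero) linarith+
  show "0 < sin ?\<alpha>" using 1 2 pi_gt_zero by (intro sin_gt_zero) linarith+
  have "0 \<le> cos (2 * ?\<alpha>)" using 1 2 by (intro cos_ge_zero) linarith+
  thus "2 * (sin ?\<alpha>)\<^sup>2 \<le> 1" unfolding cos_double_sin by simp
qed

lemma cheb_pt_ends:
  assumes "r \<ge> 1"
  shows "cheb_pt r 0 = -1" "cheb_pt r r = 1"
proof -
  note c = cheb_angle(3)[OF assms]
  show "cheb_pt r 0 = -1" using c by (simp add: cheb_pt_def)
  have "(2 * real r + 1) / (2 * real r + 2) * pi = pi - pi / (2 * real r + 2)"
    by (simp add: field_simps)
  thus "cheb_pt r r = 1" using c by (simp add: cheb_pt_def)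
qed

text \<open>The difference of cosines is the product 2 sin ((k + k' + 1)\<alpha>) sin ((k' -
  k)\<alpha>). Its angles lie in [2\<alpha>, \<pi> - 2\<alpha>] and [\<alpha>, \<pi> - \<alpha>], so
  it is at least 2 sin (2\<alpha>) sin \<alpha> = 4 sin^2(\<alpha>) cos \<alpha>, and the cosine
  cancels against the normalisation of the nodes. Equality holds for k = 0, k' = 1.\<close>

lemma cheb_pt_gap:
  assumes r: "r \<ge> 1" and k: "k < k'" "k' \<le> r"
  shows "cheb_pt r k + 4 * (sin (pi / (2 * real r + 2)))\<^sup>2 \<le> cheb_pt r k'"
proof -
  define \<alpha> where "\<alpha> = pi / (2 * real r + 2)"
  note \<alpha> = cheb_angle[OF r, folded \<alpha>_def]
  have r\<alpha>: "(2 * real r + 2) * \<alpha> = pi" by (simp add: \<alpha>_def)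
  have ang: "(2 * real l + 1) / (2 * real r + 2) * pi = (2 * real l + 1) * \<alpha>" for l
    by (simp add: \<alpha>_def)
  have "cos ((2 * real k + 1) * \<alpha>) - cos ((2 * real k' + 1) * \<alpha>)
      = 2 * sin ((real k + real k' + 1) * \<alpha>) * sin ((real k' - real k) * \<alpha>)"
    unfolding cos_diff_cos by (simp add: algebra_simps add_divide_distrib diff_divide_distrib)
  moreover have "sin (2 * \<alpha>) * sin \<alpha> \<le> sin ((real k + real k' + 1) * \<alpha>) * sin ((real k' - real k) * \<alpha>)"
  proof (rule mult_mono)
    have "2 * \<alpha> \<le> (real k + real k' + 1) * \<alpha>"
      using k \<alpha>(1) by (intro mult_right_mono) auto
    moreover have "(real k + real k' + 1) * \<alpha> \<le> (2 * real r) * \<alpha>"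
      using k \<alpha>(1) by (intro mult_right_mono) auto
    moreover have "(2 * real r) * \<alpha> = pi - 2 * \<alpha>" using r\<alpha> by (simp add: algebra_simps)
    ultimately show *: "sin (2 * \<alpha>) \<le> sin ((real k + real k' + 1) * \<alpha>)"
      using \<alpha>(1) by (intro sin_ge_sin_if_between) auto
    have "0 \<le> sin (2 * \<alpha>)" using \<alpha> by (simp add: sin_double)
    with * show "0 \<le> sin ((real k + real k' + 1) * \<alpha>)" by simp
    have "1 * \<alpha> \<le> (real k' - real k) * \<alpha>"
      using k \<alpha>(1) by (intro mult_right_mono) auto
    moreover have "(real k' - real k) * \<alpha> \<le> (2 * real r + 1) * \<alpha>"
      using k \<alpha>(1) by (intro mult_right_mono) auto
    moreover have "(2 * real r + 1) * \<alpha> = pi - \<alpha>" using r\<alpha> by (simp add: algebra_simps)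
    ultimately show "sin \<alpha> \<le> sin ((real k' - real k) * \<alpha>)"
      using \<alpha>(1) by (intro sin_ge_sin_if_between) auto
  qed (use \<alpha> in auto)
  moreover have "2 * (sin (2 * \<alpha>) * sin \<alpha>) = 4 * (sin \<alpha>)\<^sup>2 * cos \<alpha>"
    by (simp add: sin_double power2_eq_square)
  ultimately have "4 * (sin \<alpha>)\<^sup>2 * cos \<alpha> \<le> cos ((2 * real k + 1) * \<alpha>) - cos ((2 * real k' + 1) * \<alpha>)"
    by linarith
  hence "4 * (sin \<alpha>)\<^sup>2 \<le> (cos ((2 * real k + 1) * \<alpha>) - cos ((2 * real k' + 1) * \<alpha>)) / cos \<alpha>"
    using \<alpha>(3) by (simp add: pos_le_divide_eq)
  thus ?thesis unfolding cheb_pt_def ang \<alpha>_def[symmetric] by (simp add: diff_divide_distrib)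
qed

section \<open>The collocation mesh\<close>

locale colloc_mesh =
  fixes A B :: "nat \<Rightarrow> real" and N :: "nat \<Rightarrow> nat" and I r :: nat
  assumes r: "r \<ge> 1"
    and AB: "i \<in> {1..I} \<Longrightarrow> A i < B i"
    and BA: "1 \<le> i \<Longrightarrow> i < I \<Longrightarrow> B i < A (i + 1)"
    and N: "i \<in> {1..I} \<Longrightarrow> N i \<ge> 1"
begin

abbreviation "\<alpha> \<equiv> pi / (2 * real r + 2)"
abbreviation "hh \<equiv> mesh A B N"
abbreviation "tt \<equiv> mesh_pt A B N"
abbreviation "cc \<equiv> colloc_pt A B N r"
abbreviation "T \<equiv> colloc_set A B N I r"

lemma hh_pos: "i \<in> {1..I} \<Longrightarrow> hh i > 0"
  using AB[of i] N[of i] by (simp add: mesh_def)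

lemma tt_0: "tt i 0 = A i" by (simp add: mesh_pt_def)

lemma tt_N: "i \<in> {1..I} \<Longrightarrow> tt i (N i) = B i"
  using N[of i] by (simp add: mesh_pt_def mesh_def)

lemma tt_step: "j \<ge> 1 \<Longrightarrow> tt i j = tt i (j - 1) + hh i"
  by (simp add: mesh_pt_def of_nat_diff algebra_simps)

lemma tt_mono: "i \<in> {1..I} \<Longrightarrow> j \<le> j' \<Longrightarrow> tt i j \<le> tt i j'"
  using hh_pos[of i] by (simp add: mesh_pt_def)

lemma tt_in: "i \<in> {1..I} \<Longrightarrow> j \<le> N i \<Longrightarrow> tt i j \<in> {A i..B i}"
  using tt_mono[of i 0 j] tt_mono[of i j "N i"] tt_0 tt_N by simp

lemma A_Suc_le: "1 \<le> i \<Longrightarrow> i < i' \<Longrightarrow> i' \<le> I \<Longrightarrow> A (i + 1) \<le> A i'"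
proof (induction i')
  case (Suc i')
  show ?case
  proof (cases "i = i'")
    case False
    hence "A (i + 1) \<le> A i'" using Suc by auto
    moreover have "A i' < B i'" using AB[of i'] Suc.prems by auto
    moreover have "B i' < A (i' + 1)" using BA[of i'] Suc.prems by auto
    ultimately show ?thesis by simp
  qed simp
qed simp

lemma cc_ends:
  assumes "j \<ge> 1"
  shows "cc i j 0 = tt i (j - 1)" "cc i j r = tt i j"
  using tt_step[OF assms] by (simp_all add: colloc_pt_def cheb_pt_ends[OF r])

text \<open>The affine map from [-1, 1] onto a subinterval scales by half its length, which turns
  the factor 4 of the reference nodes into 2.\<close>

lemma cc_gap:
  assumes "i \<in> {1..I}" "k < k'" "k' \<le> r"
  shows "cc i j k + 2 * (sin \<alpha>)\<^sup>2 * hh i \<le> cc i j k'"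
proof -
  have "hh i * (cheb_pt r k + 4 * (sin \<alpha>)\<^sup>2) \<le> hh i * cheb_pt r k'"
    using hh_pos[OF assms(1)] cheb_pt_gap[OF r assms(2,3)] by (intro mult_left_mono) auto
  thus ?thesis by (simp add: colloc_pt_def algebra_simps add_divide_distrib)
qed

lemma gap_pos: "i \<in> {1..I} \<Longrightarrow> 2 * (sin \<alpha>)\<^sup>2 * hh i > 0"
  using cheb_angle(4)[OF r] hh_pos[of i] by simp

lemma cc_inj: "i \<in> {1..I} \<Longrightarrow> inj_on (cc i j) {..r}"
proof (rule inj_onI)
  fix k k' assume "i \<in> {1..I}" "k \<in> {..r}" "k' \<in> {..r}" "cc i j k = cc i j k'"
  thus "k = k'"
    using cc_gap[of i k k' j] cc_gap[of i k' k j] gap_pos[of i]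
    by (cases k k' rule: linorder_cases) auto
qed

lemma cc_mono: "i \<in> {1..I} \<Longrightarrow> k \<le> k' \<Longrightarrow> k' \<le> r \<Longrightarrow> cc i j k \<le> cc i j k'"
proof (cases "k = k'")
  case False
  assume a: "i \<in> {1..I}" "k \<le> k'" "k' \<le> r"
  hence "cc i j k + 2 * (sin \<alpha>)\<^sup>2 * hh i \<le> cc i j k'" using False by (intro cc_gap) auto
  thus ?thesis using gap_pos[OF a(1)] by linarith
qed simp

lemma cc_in_subinterval:
  assumes "i \<in> {1..I}" "j \<ge> 1" "k \<le> r"
  shows "cc i j k \<in> {tt i (j - 1)..tt i j}"
  using cc_mono[OF assms(1), of 0 k j] cc_mono[OF assms(1), of k r j] assms cc_ends[of j i] by auto

lemma cc_in: "i \<in> {1..I} \<Longrightarrow> j \<in> {1..N i} \<Longrightarrow> k \<le> r \<Longrightarrow> cc i j k \<in> {A i..B i}"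
  using cc_in_subinterval[of i j k] tt_mono[of i 0 "j - 1"] tt_in[of i j] by (auto simp: tt_0)

lemma T_eq: "T = (\<Union>i\<in>{1..I}. \<Union>j\<in>{1..N i}. cc i j ` {..r})"
  unfolding colloc_set_def by blast

lemma finite_T: "finite T" unfolding T_eq by blast

lemma cc_in_T: "i \<in> {1..I} \<Longrightarrow> j \<in> {1..N i} \<Longrightarrow> k \<le> r \<Longrightarrow> cc i j k \<in> T"
  unfolding T_eq by blast

lemma subinterval_exists:
  assumes i: "i \<in> {1..I}" and x: "x \<in> {A i..B i}"
  shows "\<exists>j\<in>{1..N i}. x \<in> {tt i (j - 1)..tt i j}"
proof -
  define j where "j = (LEAST j. x \<le> tt i j)"
  have xN: "x \<le> tt i (N i)" using x tt_N[OF i] by simp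
  have j: "x \<le> tt i j" "j \<le> N i" using LeastI[of "\<lambda>j. x \<le> tt i j", OF xN]
      Least_le[of "\<lambda>j. x \<le> tt i j", OF xN] by (auto simp: j_def)
  \<comment> \<open>The least index is 0 only for x = A i; then the first subinterval is taken,
    because subintervals are numbered from 1.\<close>
  show ?thesis
  proof (cases "j = 0")
    case True
    hence "x = tt i 0" using j x tt_0 by simp
    thus ?thesis using N[OF i] tt_mono[OF i, of 0 1] by (intro bexI[of _ 1]) auto
  next
    case False
    hence "\<not> x \<le> tt i (j - 1)" using not_less_Least[of "j - 1" "\<lambda>j. x \<le> tt i j"] by (simp add: j_def)
    thus ?thesis using j False by (intro bexI[of _ j]) auto
  qed
qed

lemma interval_unique:
  assumes "i \<in> {1..I}" "i' \<in> {1..I}" "x \<in> {A i..B i}" "x \<in> {A i'..B i'}"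
  shows "i = i'"
proof -
  have "B i < A i'" if "i < i'" "1 \<le> i" "i' \<le> I" for i i'
    using A_Suc_le[of i i'] BA[of i] that by auto
  thus ?thesis using assms by (cases i i' rule: linorder_cases) fastforce+
qed

text \<open>Two points in different intervals are kept apart by \<open>sep\<close>, two nodes of one
  subinterval by \<open>cc_gap\<close>. The delicate case is that of different subintervals of one
  interval, because neighbours share a mesh point that is a node of both.\<close>

lemma T_separated:
  assumes sep: "\<And>i. 1 \<le> i \<Longrightarrow> i < I \<Longrightarrow> 2 * (sin \<alpha>)\<^sup>2 * hh i \<le> A (i + 1) - B i"
    and xi: "\<xi> \<in> T" "\<eta> \<in> T" "\<xi> \<noteq> \<eta>"
  shows "2 * (sin \<alpha>)\<^sup>2 * Min (hh ` {1..I}) \<le> \<bar>\<xi> - \<eta>\<bar>"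
proof -
  let ?m = "Min (hh ` {1..I})"
  have m: "2 * (sin \<alpha>)\<^sup>2 * ?m \<le> 2 * (sin \<alpha>)\<^sup>2 * hh i" if "i \<in> {1..I}" for i
    using that by (intro mult_left_mono Min_le) auto
  have gap1: "2 * (sin \<alpha>)\<^sup>2 * hh i \<le> y - x"
    if i: "i \<in> {1..I}" and j: "j < j'" "j \<in> {1..N i}" and k: "k \<le> r" "k' \<le> r"
      and xy: "x = cc i j k" "y = cc i j' k'" "x \<noteq> y" for i j j' k k' x y
  proof -
    have tj: "tt i j \<le> tt i (j' - 1)" using j by (intro tt_mono[OF i]) auto
    have x: "x \<le> tt i j" and y: "tt i (j' - 1) \<le> y"
      using cc_in_subinterval[OF i, of j k] cc_in_subinterval[OF i, of j' k'] j k xy by auto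
    \<comment> \<open>Either x stays one node gap below the right end of its subinterval, or y stays
      one above the left end of its own, or both are mesh points. In the last case x and y differ,
      so a whole subinterval separates them.\<close>
    consider "k < r" | "k' > 0" | "k = r" "k' = 0" using k by linarith
    thus ?thesis
    proof cases
      case 1
      hence "x + 2 * (sin \<alpha>)\<^sup>2 * hh i \<le> tt i j"
        using cc_gap[OF i 1, of j] cc_ends(2)[of j i] j xy by auto
      thus ?thesis using tj y by simp
    next
      case 2
      hence "tt i (j' - 1) + 2 * (sin \<alpha>)\<^sup>2 * hh i \<le> y"
        using cc_gap[OF i 2, of j'] cc_ends(1)[of j' i] j k xy by auto
      thus ?thesis using tj x by simp
    next
      case 3
      hence e: "x = tt i j" "y = tt i (j' - 1)" using cc_ends[of j i] cc_ends[of j' i] j xy by auto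
      hence "j \<noteq> j' - 1" using xy by auto
      hence "tt i (j + 1) \<le> tt i (j' - 1)" using j by (intro tt_mono[OF i]) auto
      hence "hh i \<le> y - x" using e tt_step[of "j + 1" i] by simp
      moreover have "2 * (sin \<alpha>)\<^sup>2 * hh i \<le> 1 * hh i"
        using cheb_angle(5)[OF r] hh_pos[OF i] by (intro mult_right_mono) auto
      ultimately show ?thesis by simp
    qed
  qed
  have gap2: "2 * (sin \<alpha>)\<^sup>2 * hh i \<le> y - x"
    if "i \<in> {1..I}" "i' \<in> {1..I}" "i < i'" "x \<in> {A i..B i}" "y \<in> {A i'..B i'}" for i i' x y
    using that A_Suc_le[of i i'] sep[of i] by auto
  obtain i j k where x: "i \<in> {1..I}" "j \<in> {1..N i}" "k \<le> r" "\<xi> = cc i j k"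
    using xi(1) unfolding T_eq by auto
  obtain i' j' k' where y: "i' \<in> {1..I}" "j' \<in> {1..N i'}" "k' \<le> r" "\<eta> = cc i' j' k'"
    using xi(2) unfolding T_eq by auto
  have x': "\<xi> \<in> {A i..B i}" and y': "\<eta> \<in> {A i'..B i'}" using cc_in x y by auto
  consider "i < i'" | "i' < i" | "i = i'" "j < j'" | "i = i'" "j' < j"
    | "i = i'" "j = j'" "k < k'" | "i = i'" "j = j'" "k' < k"
    using xi(3) x(4) y(4) by (metis linorder_neqE_nat)
  thus ?thesis
  proof cases
    case 1 thus ?thesis using gap2[OF x(1) y(1) _ x' y'] m[OF x(1)] by simp
  next
    case 2 thus ?thesis using gap2[OF y(1) x(1) _ y' x'] m[OF y(1)] by simp
  next
    case 3 thus ?thesis using gap1[of i j j' k k' \<xi> \<eta>] x y xi(3) m[OF x(1)] by simp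
  next
    case 4 thus ?thesis using gap1[of i j' j k' k \<eta> \<xi>] x y xi(3) m[OF x(1)] by simp
  next
    case 5 thus ?thesis using cc_gap[of i k k' j] x y m[OF x(1)] by simp
  next
    case 6 thus ?thesis using cc_gap[of i k' k j] x y m[OF x(1)] by simp
  qed
qed

text \<open>In the reference coordinate y in [-1, 1] each factor is \<open>hh i\<close> / (2 cos
  \<alpha>) times y cos \<alpha> + cos(...), so the Chebyshev estimate applies at u = y cos
  \<alpha>. This is the origin of the factors 1 / (2 cos \<alpha>)^(r+1) and 1 / 2^r in G.\<close>

lemma node_prod_bound:
  assumes i: "i \<in> {1..I}" and j: "j \<ge> 1" and x: "x \<in> {tt i (j - 1)..tt i j}"
  shows "\<bar>\<Prod>y\<in>cc i j ` {..r}. x - y\<bar> \<le> (hh i * (1 / (2 * cos \<alpha>))) ^ (r + 1) * (1 / 2 ^ r)"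
proof -
  note c = cheb_angle(3)[OF r] and h = hh_pos[OF i]
  define y where "y = 2 * ((x - tt i (j - 1)) / hh i) - 1"
  have xy: "x = tt i (j - 1) + hh i * (1 + y) / 2" using h by (simp add: y_def field_simps)
  have "0 \<le> (x - tt i (j - 1)) / hh i" "(x - tt i (j - 1)) / hh i \<le> 1"
    using x h tt_step[OF j, of i] by (auto simp: field_simps)
  hence y1: "\<bar>y\<bar> \<le> 1" unfolding y_def abs_le_iff by linarith
  have fac: "x - cc i j k = (hh i * (1 / (2 * cos \<alpha>))) *
      (y * cos \<alpha> + cos ((2 * real k + 1) / (2 * real r + 2) * pi))" for k
    unfolding xy colloc_pt_def cheb_pt_def using c by (simp add: field_simps)
  have "(\<Prod>y\<in>cc i j ` {..r}. x - y) = (\<Prod>k\<le>r. x - cc i j k)"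
    using prod.reindex[OF cc_inj[OF i]] by simp
  also have "\<dots> = (hh i * (1 / (2 * cos \<alpha>))) ^ (r + 1) *
      (\<Prod>k\<le>r. y * cos \<alpha> + cos ((2 * real k + 1) / (2 * real r + 2) * pi))"
    by (simp only: fac prod.distrib prod_constant card_atMost Suc_eq_plus1 power_mult_distrib)
  finally have eq: "(\<Prod>y\<in>cc i j ` {..r}. x - y) = (hh i * (1 / (2 * cos \<alpha>))) ^ (r + 1) *
      (\<Prod>k\<le>r. y * cos \<alpha> + cos ((2 * real k + 1) / (2 * real r + 2) * pi))" .
  have "\<bar>y * cos \<alpha>\<bar> \<le> 1 * 1" unfolding abs_mult using y1 c by (intro mult_mono) auto
  hence "\<bar>\<Prod>k\<le>r. y * cos \<alpha> + cos ((2 * real k + 1) / (2 * real r + 2) * pi)\<bar> \<le> 1 / 2 ^ r"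
    by (intro chebyshev_node_prod_bound) simp
  moreover have nn: "0 \<le> (hh i * (1 / (2 * cos \<alpha>))) ^ (r + 1)" using h c by simp
  ultimately show ?thesis unfolding eq abs_mult abs_of_nonneg[OF nn] by (rule mult_left_mono)
qed

text \<open>This discharges the definite description. Disjointness fixes the interval, and within
  one subinterval r + 1 nodes determine a polynomial of degree at most r.\<close>

lemma pw_interp_eq:
  assumes i: "i \<in> {1..I}" and j: "j \<in> {1..N i}" and x: "x \<in> {tt i (j - 1)..tt i j}"
    and P: "degree P \<le> r" "\<And>k. k \<le> r \<Longrightarrow> poly P (cc i j k) = F (cc i j k)"
  shows "pw_interp A B N I r F x = poly P x"
  unfolding pw_interp_def
proof (rule the_equality)
  show "\<exists>i\<in>{1..I}. \<exists>j\<in>{1..N i}. \<exists>Q. x \<in> {tt i (j - 1)..tt i j} \<and> degree Q \<le> r \<and>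
      (\<forall>k\<le>r. poly Q (cc i j k) = F (cc i j k)) \<and> poly P x = poly Q x"
    using assms by blast
next
  \<comment> \<open>A point of two subintervals is their common mesh point, the last node of one and
    the first node of the other, so both polynomials take the value of \<open>F\<close>
    there.\<close>
  have shared: "poly P x = poly Q x"
    if "i \<in> {1..I}" "j \<in> {1..N i}" "j < j'" "x \<in> {tt i (j - 1)..tt i j}" "x \<in> {tt i (j' - 1)..tt i j'}"
      "\<And>k. k \<le> r \<Longrightarrow> poly P (cc i j k) = F (cc i j k)"
      "\<And>k. k \<le> r \<Longrightarrow> poly Q (cc i j' k) = F (cc i j' k)" for i j j' P Q
  proof -
    have "tt i j \<le> tt i (j' - 1)" using that by (intro tt_mono) auto
    hence "x = tt i j" "x = tt i (j' - 1)" using that by auto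
    thus ?thesis
      using cc_ends(2)[of j i] cc_ends(1)[of j' i] that(2,3) that(6)[of r] that(7)[of 0] by auto
  qed
  fix y
  assume "\<exists>i\<in>{1..I}. \<exists>j\<in>{1..N i}. \<exists>P. x \<in> {tt i (j - 1)..tt i j} \<and> degree P \<le> r \<and>
      (\<forall>k\<le>r. poly P (cc i j k) = F (cc i j k)) \<and> y = poly P x"
  then obtain i' j' Q where Q: "i' \<in> {1..I}" "j' \<in> {1..N i'}" "x \<in> {tt i' (j' - 1)..tt i' j'}"
    "degree Q \<le> r" "\<And>k. k \<le> r \<Longrightarrow> poly Q (cc i' j' k) = F (cc i' j' k)" "y = poly Q x" by blast
  have "x \<in> {A i..B i}" using x tt_mono[OF i, of 0 "j - 1"] tt_in[OF i, of j] j by (auto simp: tt_0)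
  moreover have "x \<in> {A i'..B i'}" using Q tt_mono[of i' 0 "j' - 1"] tt_in[of i' j'] by (auto simp: tt_0)
  ultimately have [simp]: "i' = i" using interval_unique i Q(1) by blast
  have "poly Q x = poly P x"
  proof (cases j j' rule: linorder_cases)
    case less
    thus ?thesis using shared[of i j j' P Q] i j x P Q by auto
  next
    case greater
    thus ?thesis using shared[of i j' j Q P] i j x P Q by auto
  next
    case equal
    have "Q = P"
    proof (rule poly_eqI_degree)
      fix y assume "y \<in> cc i j ` {..r}"
      thus "poly Q y = poly P y" using P Q equal by auto
    qed (use card_image[OF cc_inj[OF i, of j]] P Q in auto)
    thus ?thesis by simp
  qed
  thus "y = poly P x" using Q by simp
qed

lemma nodes:
  assumes "i \<in> {1..I}"
  shows "finite (cc i j ` {..r})" "card (cc i j ` {..r}) = Suc r"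
  using card_image[OF cc_inj[OF assms, of j]] by auto

text \<open>The choice of subinterval depends on x alone. Hence the Lagrange weights, extended by 0
  to the rest of \<open>T\<close>, serve all \<open>F\<close> at once.\<close>

lemma pw_interp_kernel:
  assumes i: "i \<in> {1..I}" and x: "x \<in> {A i..B i}"
  shows "\<exists>W. \<forall>F. pw_interp A B N I r F x = (\<Sum>y\<in>T. W y * F y)"
proof -
  obtain j where j: "j \<in> {1..N i}" and xj: "x \<in> {tt i (j - 1)..tt i j}"
    using subinterval_exists[OF i x] by blast
  let ?X = "cc i j ` {..r}"
  define W where "W y = (if y \<in> ?X then \<Prod>z\<in>?X - {y}. (x - z) / (y - z) else 0)" for y
  have "pw_interp A B N I r F x = (\<Sum>y\<in>T. W y * F y)" for F
  proof -
    obtain P where P: "degree P \<le> r" "\<forall>y\<in>?X. poly P y = F y"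
      "\<And>x. poly P x = (\<Sum>y\<in>?X. (\<Prod>z\<in>?X - {y}. (x - z) / (y - z)) * F y)"
      using lagrange_interpolation[OF nodes[OF i], where F = F] by blast
    have "pw_interp A B N I r F x = poly P x"
      by (rule pw_interp_eq[OF i j xj]) (use P in auto)
    also have "\<dots> = (\<Sum>y\<in>?X. W y * F y)" unfolding P(3) by (intro sum.cong) (auto simp: W_def)
    also have "\<dots> = (\<Sum>y\<in>T. W y * F y)"
      using finite_T cc_in_T[OF i j] by (intro sum.mono_neutral_left) (auto simp: W_def)
    finally show ?thesis .
  qed
  thus ?thesis by blast
qed

text \<open>The remainder formula involves v at an unknown \<xi>. As \<xi> and x share a subinterval
  of length at most h, the log-Lipschitz bound replaces v(\<xi>) by v(x) at the price of exp (c h);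
  for c = 2s / \<chi> this is the exponential in G, and the error becomes relative to v(x).\<close>

lemma pw_interp_relative_error:
  assumes C: "C_class_on m {a..b} v" and m: "r + 1 \<le> m"
    and pos: "\<And>t. t \<in> {a..b} \<Longrightarrow> v t > 0"
    and E: "E \<ge> 0" "\<And>t. t \<in> {a..b} \<Longrightarrow> \<bar>nth_deriv_within {a..b} (r + 1) v t\<bar> \<le> E * v t"
    and c: "c \<ge> 0" "\<And>x\<^sub>1 x\<^sub>2. x\<^sub>1 \<in> {a..b} \<Longrightarrow> x\<^sub>2 \<in> {a..b} \<Longrightarrow> v x\<^sub>1 \<le> v x\<^sub>2 * exp (c * \<bar>x\<^sub>1 - x\<^sub>2\<bar>)"
    and i: "i \<in> {1..I}" and sub: "{A i..B i} \<subseteq> {a..b}" and h: "hh i \<le> h"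
    and x: "x \<in> {A i..B i}"
  shows "\<bar>v x - pw_interp A B N I r v x\<bar> \<le>
    (E * exp (c * h) * (1 / fact (r + 1)) * (1 / (2 * cos \<alpha>)) ^ (r + 1) * (1 / 2 ^ r)) * h ^ (r + 1) * v x"
proof -
  obtain j where j: "j \<in> {1..N i}" and xj: "x \<in> {tt i (j - 1)..tt i j}"
    using subinterval_exists[OF i x] by blast
  let ?X = "cc i j ` {..r}"
  have j1: "j \<ge> 1" using j by simp
  obtain P where P: "degree P \<le> r" "\<forall>y\<in>?X. poly P y = v y"
    using lagrange_interpolation[OF nodes[OF i], where F = v] by blast
  have V: "pw_interp A B N I r v x = poly P x"
    by (rule pw_interp_eq[OF i j xj]) (use P in auto)
  have subj: "{tt i (j - 1)..tt i j} \<subseteq> {a..b}"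
  proof -
    have "{tt i (j - 1)..tt i j} \<subseteq> {A i..B i}"
      using tt_mono[OF i, of 0 "j - 1"] tt_in[OF i, of j] j by (auto simp: tt_0)
    thus ?thesis using sub by blast
  qed
  have m': "Suc r \<le> m" using m by simp
  have Xs: "?X \<subseteq> {tt i (j - 1)..tt i j}" using cc_in_subinterval[OF i j1] by blast
  obtain \<xi> where \<xi>: "\<xi> \<in> {tt i (j - 1)..tt i j}" and err: "v x - poly P x =
      nth_deriv_within {a..b} (Suc r) v \<xi> / fact (Suc r) * (\<Prod>y\<in>?X. x - y)"
    using interpolation_error[OF C m' subj nodes(1)[OF i] Xs nodes(2)[OF i] P(1) _ xj] P(2) by blast
  have \<xi>S: "\<xi> \<in> {a..b}" and xS: "x \<in> {a..b}" using \<xi> xj subj by auto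
  have "\<bar>\<xi> - x\<bar> \<le> h" using \<xi> xj tt_step[OF j1, of i] h by auto
  hence "exp (c * \<bar>\<xi> - x\<bar>) \<le> exp (c * h)" using c(1) by (simp add: mult_left_mono)
  hence "v x * exp (c * \<bar>\<xi> - x\<bar>) \<le> v x * exp (c * h)"
    using pos[OF xS] by (intro mult_left_mono) auto
  hence "v \<xi> \<le> v x * exp (c * h)" using c(2)[OF \<xi>S xS] by linarith
  hence D: "\<bar>nth_deriv_within {a..b} (Suc r) v \<xi>\<bar> \<le> E * (v x * exp (c * h))"
    using E(2)[OF \<xi>S] E(1) by (simp del: nth_deriv_within.simps) (meson mult_left_mono order_trans)
  have c0: "0 < cos \<alpha>" by (rule cheb_angle(3)[OF r])
  have h0: "0 \<le> hh i" using hh_pos[OF i] by simp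
  have "\<bar>v x - poly P x\<bar> = \<bar>nth_deriv_within {a..b} (Suc r) v \<xi>\<bar> / fact (Suc r) * \<bar>\<Prod>y\<in>?X. x - y\<bar>"
    unfolding err abs_mult abs_divide by (simp del: nth_deriv_within.simps)
  also have "\<dots> \<le> E * (v x * exp (c * h)) / fact (Suc r) * ((h * (1 / (2 * cos \<alpha>))) ^ (r + 1) * (1 / 2 ^ r))"
  proof (rule mult_mono)
    show "\<bar>nth_deriv_within {a..b} (Suc r) v \<xi>\<bar> / fact (Suc r) \<le> E * (v x * exp (c * h)) / fact (Suc r)"
      by (rule divide_right_mono[OF D]) (rule fact_ge_zero)
    have "\<bar>\<Prod>y\<in>?X. x - y\<bar> \<le> (hh i * (1 / (2 * cos \<alpha>))) ^ (r + 1) * (1 / 2 ^ r)"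
      by (rule node_prod_bound[OF i j1 xj])
    also have "\<dots> \<le> (h * (1 / (2 * cos \<alpha>))) ^ (r + 1) * (1 / 2 ^ r)"
      using h h0 c0 by (intro mult_right_mono power_mono) auto
    finally show "\<bar>\<Prod>y\<in>?X. x - y\<bar> \<le> (h * (1 / (2 * cos \<alpha>))) ^ (r + 1) * (1 / 2 ^ r)" .
    show "0 \<le> E * (v x * exp (c * h)) / fact (Suc r)"
      using E(1) pos[OF xS] by (intro divide_nonneg_nonneg mult_nonneg_nonneg fact_ge_zero) auto
  qed simp
  also have "\<dots> = (E * exp (c * h) * (1 / fact (r + 1)) * (1 / (2 * cos \<alpha>)) ^ (r + 1) * (1 / 2 ^ r)) * h ^ (r + 1) * v x"
    unfolding power_mult_distrib by (simp add: mult_ac del: fact_Suc power_Suc)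
  finally show ?thesis unfolding V .
qed

end

section \<open>The cone of log-Lipschitz functions\<close>

text \<open>For y = (1 + x) / (1 - x) this is ln y \<le> sinh (ln y), because sinh (ln y) = (y -
  1/y) / 2 = 2x / (1 - x^2).\<close>

lemma ratio_le_exp:
  fixes x :: real
  assumes "0 \<le> x" "x < 1"
  shows "(1 + x) / (1 - x) \<le> exp (2 * x / (1 - x\<^sup>2))"
proof -
  define y where "y = (1 + x) / (1 - x)"
  have y: "y \<ge> 1" using assms by (simp add: y_def)
  have "x * x < 1" using assms mult_strict_mono[of x 1 x 1] by auto
  hence ne: "1 - x \<noteq> 0" "1 + x \<noteq> 0" "1 - x\<^sup>2 \<noteq> 0" using assms by (auto simp: power2_eq_square)
  have "ln y \<le> (exp (ln y) - inverse (exp (ln y))) / 2"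
    using y by (intro real_le_x_sinh) simp
  also have "\<dots> = (y - inverse y) / 2" using y by simp
  also have "\<dots> = ((1 + x)\<^sup>2 - (1 - x)\<^sup>2) / ((1 - x) * (1 + x)) / 2"
    using ne by (simp add: y_def power2_eq_square diff_divide_eq_iff divide_diff_eq_iff field_simps)
  also have "(1 + x)\<^sup>2 - (1 - x)\<^sup>2 = 2 * (2 * x)" by (simp add: power2_eq_square algebra_simps)
  also have "(1 - x) * (1 + x) = 1 - x\<^sup>2" by (simp add: power2_eq_square algebra_simps)
  also have "2 * (2 * x) / (1 - x\<^sup>2) / 2 = 2 * x / (1 - x\<^sup>2)" using ne by (simp add: field_simps)
  finally have "ln y \<le> 2 * x / (1 - x\<^sup>2)" .
  hence "exp (ln y) \<le> exp (2 * x / (1 - x\<^sup>2))" by (simp only: exp_le_cancel_iff)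
  moreover have "exp (ln y) = y" using y by simp
  ultimately show ?thesis by (simp only: y_def)
qed

lemma log_lip_cone_cong:
  assumes "f \<in> log_lip_cone M T" "\<And>x. x \<in> T \<Longrightarrow> g x = f x"
  shows "g \<in> log_lip_cone M T"
  using assms by (auto simp: log_lip_cone_def)

lemma log_lip_cone_add:
  assumes "f \<in> log_lip_cone M T" "g \<in> log_lip_cone M T"
  shows "(\<lambda>x. f x + g x) \<in> log_lip_cone M T"
  using assms by (auto simp: log_lip_cone_def distrib_left intro!: add_mono)

lemma log_lip_cone_scale:
  assumes "c \<ge> 0" "f \<in> log_lip_cone M T"
  shows "(\<lambda>x. c * f x) \<in> log_lip_cone M T"
  using assms mult_left_mono[OF _ assms(1)] by (auto simp: log_lip_cone_def mult.left_commute)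

text \<open>Going from \<open>\<xi>\<close> to a second point and back gives \<open>F \<xi> \<le> q * F \<xi>\<close> with \<open>q > 1\<close>.\<close>

lemma log_lip_cone_nonneg:
  assumes M: "M > 0" and T: "\<xi> \<in> T" "\<eta> \<in> T" "\<xi> \<noteq> \<eta>" and F: "F \<in> log_lip_cone M T"
  shows "F \<xi> \<ge> 0"
proof -
  let ?e = "exp (M * \<bar>\<xi> - \<eta>\<bar>)"
  have e: "?e > 1" using M T by simp
  have "F \<xi> \<le> ?e * F \<eta>" "F \<eta> \<le> ?e * F \<xi>"
    using F T by (auto simp: log_lip_cone_def abs_minus_commute)
  hence "F \<xi> \<le> ?e * (?e * F \<xi>)" using e by (meson mult_left_mono order_trans exp_ge_zero)
  hence "0 \<le> (?e * ?e - 1) * F \<xi>" by (simp add: algebra_simps)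
  moreover have "?e * ?e > 1" using e by (simp add: less_1_mult)
  ultimately show ?thesis by (simp add: zero_le_mult_iff)
qed

lemma log_lip_cone_mono:
  assumes M: "M' \<le> M" and F: "F \<in> log_lip_cone M' T" "\<And>x. x \<in> T \<Longrightarrow> F x \<ge> 0"
  shows "F \<in> log_lip_cone M T"
proof -
  have "F \<xi> \<le> exp (M * \<bar>\<xi> - \<eta>\<bar>) * F \<eta>" if "\<xi> \<in> T" "\<eta> \<in> T" for \<xi> \<eta>
  proof -
    have "F \<xi> \<le> exp (M' * \<bar>\<xi> - \<eta>\<bar>) * F \<eta>" using F(1) that by (auto simp: log_lip_cone_def)
    also have "\<dots> \<le> exp (M * \<bar>\<xi> - \<eta>\<bar>) * F \<eta>"
      using M F(2)[OF that(2)] by (intro mult_right_mono) (auto intro: mult_right_mono)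
    finally show ?thesis .
  qed
  thus ?thesis by (auto simp: log_lip_cone_def)
qed

text \<open>The perturbation multiplies quotients of values by at most (1 + x) / (1 - x) \<le> exp
  (2x / (1 - x^2)). This constant can be charged to the distance because distinct points are at
  least \<delta> apart, which raises the Lipschitz constant by 2x / (1 - x^2) / \<delta>.\<close>

lemma log_lip_cone_perturb:
  assumes w: "w \<in> log_lip_cone c T" "\<And>x. x \<in> T \<Longrightarrow> w x > 0"
    and sep: "\<delta> > 0" "\<And>\<xi> \<eta>. \<xi> \<in> T \<Longrightarrow> \<eta> \<in> T \<Longrightarrow> \<xi> \<noteq> \<eta> \<Longrightarrow> \<delta> \<le> \<bar>\<xi> - \<eta>\<bar>"
    and x: "0 \<le> x" "x < 1"
    and F: "\<And>\<xi>. \<xi> \<in> T \<Longrightarrow> \<bar>F \<xi> - w \<xi>\<bar> \<le> x * w \<xi>"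
    and M: "c + 2 * x / (1 - x\<^sup>2) / \<delta> \<le> M"
  shows "F \<in> log_lip_cone M T"
proof -
  have "F \<xi> \<le> exp (M * \<bar>\<xi> - \<eta>\<bar>) * F \<eta>" if T: "\<xi> \<in> T" "\<eta> \<in> T" and ne: "\<xi> \<noteq> \<eta>" for \<xi> \<eta>
  proof -
    let ?d = "\<bar>\<xi> - \<eta>\<bar>" and ?y = "2 * x / (1 - x\<^sup>2)"
    have "x * x < 1" using x mult_strict_mono[of x 1 x 1] by auto
    hence y0: "?y \<ge> 0" using x by (simp add: power2_eq_square)
    have d: "\<delta> \<le> ?d" using sep(2) T ne by simp
    have low: "w \<eta> * (1 - x) \<le> F \<eta>" using F[OF T(2)] by (simp add: algebra_simps abs_le_iff)
    have F\<eta>: "F \<eta> \<ge> 0" using low mult_pos_pos[OF w(2)[OF T(2)], of "1 - x"] x by linarith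
    have w\<eta>: "w \<eta> \<le> F \<eta> / (1 - x)" using low x by (simp add: field_simps)
    have "F \<xi> \<le> (1 + x) * w \<xi>" using F[OF T(1)] by (simp add: algebra_simps abs_le_iff)
    also have "\<dots> \<le> (1 + x) * (exp (c * ?d) * w \<eta>)"
      using w(1) T x by (intro mult_left_mono) (auto simp: log_lip_cone_def)
    also have "\<dots> \<le> (1 + x) * (exp (c * ?d) * (F \<eta> / (1 - x)))"
      using w\<eta> x by (intro mult_left_mono) auto
    also have "\<dots> = (1 + x) / (1 - x) * (exp (c * ?d) * F \<eta>)" by simp
    also have "\<dots> \<le> exp ?y * (exp (c * ?d) * F \<eta>)"
      using F\<eta> by (intro mult_right_mono ratio_le_exp x) auto
    also have "\<dots> = exp (?y + c * ?d) * F \<eta>" by (simp add: exp_add)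
    also have "\<dots> \<le> exp (M * ?d) * F \<eta>"
    proof (intro mult_right_mono F\<eta>)
      have "?y = ?y / \<delta> * \<delta>" using sep(1) by simp
      also have "\<dots> \<le> ?y / \<delta> * ?d" by (rule mult_left_mono[OF d divide_nonneg_pos[OF y0 sep(1)]])
      finally have "?y + c * ?d \<le> (c + ?y / \<delta>) * ?d" by (simp add: distrib_right)
      also have "\<dots> \<le> M * ?d" using M by (intro mult_right_mono) auto
      finally show "exp (?y + c * ?d) \<le> exp (M * ?d)" by simp
    qed
    finally show ?thesis .
  qed
  moreover have "F \<xi> \<le> exp (M * \<bar>\<xi> - \<xi>\<bar>) * F \<xi>" for \<xi> by simp
  ultimately show ?thesis unfolding log_lip_cone_def by blast
qed

text \<open>Since c < M and w > 0, each of the finitely many inequalities between distinct points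
  holds strictly for w, with slack \<open>D\<close>. A large multiple of w therefore absorbs any
  f.\<close>

lemma log_lip_cone_order_unit:
  assumes fin: "finite T" and cM: "c < M"
    and w: "w \<in> log_lip_cone c T" "\<And>x. x \<in> T \<Longrightarrow> w x > 0"
  shows "\<exists>C\<ge>0. (\<lambda>x. C * w x + f x) \<in> log_lip_cone M T"
proof -
  let ?e = "\<lambda>\<xi> \<eta>. exp (M * \<bar>\<xi> - \<eta>\<bar>)"
  define D where "D \<xi> \<eta> = ?e \<xi> \<eta> * w \<eta> - w \<xi>" for \<xi> \<eta>
  have D: "D \<xi> \<eta> > 0" if "\<xi> \<in> T" "\<eta> \<in> T" "\<xi> \<noteq> \<eta>" for \<xi> \<eta>
  proof -
    have "w \<xi> \<le> exp (c * \<bar>\<xi> - \<eta>\<bar>) * w \<eta>" using w(1) that by (auto simp: log_lip_cone_def)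
    also have "\<dots> < ?e \<xi> \<eta> * w \<eta>"
      using cM that w(2) by (intro mult_strict_right_mono) auto
    finally show ?thesis by (simp add: D_def)
  qed
  \<comment> \<open>The sum dominates every quotient needed. Diagonal pairs have slack 0, and
    division by zero makes their terms 0.\<close>
  define C where "C = (\<Sum>(\<xi>, \<eta>)\<in>T \<times> T. \<bar>(f \<xi> - ?e \<xi> \<eta> * f \<eta>) / D \<xi> \<eta>\<bar>)"
  have C0: "C \<ge> 0" unfolding C_def by (intro sum_nonneg) auto
  have "C * w \<xi> + f \<xi> \<le> ?e \<xi> \<eta> * (C * w \<eta> + f \<eta>)" if T: "\<xi> \<in> T" "\<eta> \<in> T" for \<xi> \<eta>
  proof (cases "\<xi> = \<eta>")
    case False
    have "\<bar>(f \<xi> - ?e \<xi> \<eta> * f \<eta>) / D \<xi> \<eta>\<bar> \<le> C"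
      unfolding C_def
      using member_le_sum[of "(\<xi>, \<eta>)" "T \<times> T" "\<lambda>(\<xi>, \<eta>). \<bar>(f \<xi> - ?e \<xi> \<eta> * f \<eta>) / D \<xi> \<eta>\<bar>"] T fin
      by auto
    hence "(f \<xi> - ?e \<xi> \<eta> * f \<eta>) / D \<xi> \<eta> \<le> C" by (rule abs_le_D1)
    hence "f \<xi> - ?e \<xi> \<eta> * f \<eta> \<le> C * D \<xi> \<eta>" using D[OF T False] by (simp add: pos_divide_le_eq)
    thus ?thesis by (simp add: D_def algebra_simps)
  qed simp
  thus ?thesis using C0 by (auto simp: log_lip_cone_def)
qed

section \<open>Iterates of the transfer operator\<close>

lemma word_map_in:
  assumes "\<And>p. p \<in> {1..n} \<Longrightarrow> \<theta> p ` S \<subseteq> S" "set \<omega> \<subseteq> {1..n}" "t \<in> S"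
  shows "word_map \<theta> \<omega> t \<in> S"
  using assms(2) by (induction \<omega>) (use assms(1,3) in auto)

lemma word_weight_nonneg:
  assumes "\<And>p. p \<in> {1..n} \<Longrightarrow> \<theta> p ` S \<subseteq> S" "set \<omega> \<subseteq> {1..n}" "t \<in> S"
    and "\<And>p t. p \<in> {1..n} \<Longrightarrow> t \<in> S \<Longrightarrow> g p t \<ge> 0"
  shows "word_weight \<theta> g \<omega> t \<ge> (0::real)"
  using assms(2)
proof (induction \<omega>)
  case (Cons p \<omega>)
  thus ?case using word_map_in[of n \<theta> S \<omega> t, OF assms(1)] assms(3,4) by (auto intro!: mult_nonneg_nonneg)
qed simp

lemma words_0: "words n 0 = {[]}" by (auto simp: words_def)

lemma words_Suc: "words n (Suc l) = (\<lambda>(p, \<omega>). p # \<omega>) ` ({1..n} \<times> words n l)"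
  by (auto simp: words_def length_Suc_conv image_iff)

text \<open>The sum is the l-th iterate of the transfer operator applied to v. The first letter of a
  word is its outermost map, so summing over that letter first gives the transfer operator at the
  point \<open>word_map \<theta> \<omega> t\<close>, where the eigenvalue equation applies.\<close>

lemma word_sum_eigenfunction:
  assumes \<theta>: "\<And>p. p \<in> {1..n} \<Longrightarrow> \<theta> p ` S \<subseteq> S"
    and g: "\<And>p t. p \<in> {1..n} \<Longrightarrow> t \<in> S \<Longrightarrow> g p t \<ge> 0"
    and v: "\<And>t. t \<in> S \<Longrightarrow> transfer_op n \<theta> g s v t = lambda * v t"
    and t: "t \<in> S"
  shows "(\<Sum>\<omega>\<in>words n l. word_weight \<theta> g \<omega> t powr s * v (word_map \<theta> \<omega> t)) = lambda ^ l * v t"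
proof (induction l)
  case 0
  show ?case by (simp add: words_0)
next
  case (Suc l)
  have inj: "inj_on (\<lambda>(p, \<omega>). p # \<omega>) ({1..n} \<times> words n l)" by (auto simp: inj_on_def)
  have "(\<Sum>\<omega>\<in>words n (Suc l). word_weight \<theta> g \<omega> t powr s * v (word_map \<theta> \<omega> t))
      = (\<Sum>(p, \<omega>)\<in>{1..n} \<times> words n l. word_weight \<theta> g (p # \<omega>) t powr s * v (word_map \<theta> (p # \<omega>) t))"
    unfolding words_Suc sum.reindex[OF inj] by (simp add: case_prod_unfold)
  also have "\<dots> = (\<Sum>\<omega>\<in>words n l. \<Sum>p\<in>{1..n}. word_weight \<theta> g (p # \<omega>) t powr s * v (word_map \<theta> (p # \<omega>) t))"
    unfolding sum.cartesian_product[symmetric] by (rule sum.swap)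
  also have "\<dots> = (\<Sum>\<omega>\<in>words n l. lambda * (word_weight \<theta> g \<omega> t powr s * v (word_map \<theta> \<omega> t)))"
  proof (rule sum.cong)
    fix \<omega> assume "\<omega> \<in> words n l"
    hence \<omega>: "set \<omega> \<subseteq> {1..n}" by (auto simp: words_def)
    have m: "word_map \<theta> \<omega> t \<in> S" by (rule word_map_in[OF \<theta> \<omega> t])
    \<comment> \<open>Nonnegative factors are what allows \<open>powr\<close> to be distributed over
      their product.\<close>
    have "word_weight \<theta> g \<omega> t \<ge> 0" by (rule word_weight_nonneg[OF \<theta> \<omega> t g])
    hence "(\<Sum>p\<in>{1..n}. word_weight \<theta> g (p # \<omega>) t powr s * v (word_map \<theta> (p # \<omega>) t))
        = (\<Sum>p\<in>{1..n}. word_weight \<theta> g \<omega> t powr s * (g p (word_map \<theta> \<omega> t) powr s * v (\<theta> p (word_map \<theta> \<omega> t))))"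
      using g[OF _ m] by (intro sum.cong) (auto simp: powr_mult)
    also have "\<dots> = word_weight \<theta> g \<omega> t powr s * transfer_op n \<theta> g s v (word_map \<theta> \<omega> t)"
      by (simp add: transfer_op_def sum_distrib_left)
    finally show "(\<Sum>p\<in>{1..n}. word_weight \<theta> g (p # \<omega>) t powr s * v (word_map \<theta> (p # \<omega>) t))
        = lambda * (word_weight \<theta> g \<omega> t powr s * v (word_map \<theta> \<omega> t))"
      by (simp add: v[OF m])
  qed simp
  also have "\<dots> = lambda ^ Suc l * v t" by (simp add: sum_distrib_left[symmetric] Suc.IH)
  finally show ?case .
qed

theorem theorem6p6:
  fixes a b s M\<^sub>0 C\<^sub>0 \<kappa> lambda E chi h \<mu> G H M\<^sub>1 M\<^sub>2 M M' R :: real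
    and n r m \<nu> I :: nat
    and S T :: "real set"
    and \<theta> g :: "nat \<Rightarrow> real \<Rightarrow> real"
    and v :: "real \<Rightarrow> real"
    and A B :: "nat \<Rightarrow> real" and N :: "nat \<Rightarrow> nat"
  assumes "a < b" and "S = {a..b}" and "n \<ge> 1" and "s > 0" and "r \<ge> 1" and "m \<ge> r + 1"
    and "\<And>p. p \<in> {1..n} \<Longrightarrow> \<theta> p ` S \<subseteq> S \<and> C_class_on m S (\<theta> p)"
    and "\<And>p. p \<in> {1..n} \<Longrightarrow> (\<forall>t\<in>S. g p t \<ge> 0) \<and> C_class_on m S (g p) \<and> (\<exists>t\<in>S. g p t \<noteq> 0)"
    and "M\<^sub>0 > 0"
    and "\<And>p t\<^sub>1 t\<^sub>2. p \<in> {1..n} \<Longrightarrow> t\<^sub>1 \<in> S \<Longrightarrow> t\<^sub>2 \<in> S \<Longrightarrow> g p t\<^sub>1 \<le> g p t\<^sub>2 * exp (M\<^sub>0 * \<bar>t\<^sub>1 - t\<^sub>2\<bar>)"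
    and "C\<^sub>0 \<ge> 1" and "0 < \<kappa>" and "\<kappa> < 1"
    and "\<And>l \<omega> t\<^sub>1 t\<^sub>2. l \<ge> 1 \<Longrightarrow> \<omega> \<in> words n l \<Longrightarrow> t\<^sub>1 \<in> S \<Longrightarrow> t\<^sub>2 \<in> S \<Longrightarrow>
           \<bar>word_map \<theta> \<omega> t\<^sub>1 - word_map \<theta> \<omega> t\<^sub>2\<bar> \<le> C\<^sub>0 * \<kappa> ^ l * \<bar>t\<^sub>1 - t\<^sub>2\<bar>"
    and "lambda = op_spectral_radius S (transfer_op n \<theta> g s)"
    and "C_class_on m S v" and "\<And>t. t \<in> S \<Longrightarrow> v t > 0"
    and "\<And>t. t \<in> S \<Longrightarrow> transfer_op n \<theta> g s v t = lambda * v t"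
    and "E > 0" and "chi > 0"
    and "(SUP t\<in>S. \<bar>nth_deriv_within S (r + 1) v t\<bar> / v t) \<le> E"
    and "\<And>x\<^sub>1 x\<^sub>2. x\<^sub>1 \<in> S \<Longrightarrow> x\<^sub>2 \<in> S \<Longrightarrow> v x\<^sub>1 \<le> v x\<^sub>2 * exp (2 * s * \<bar>x\<^sub>1 - x\<^sub>2\<bar> / chi)"
    and "\<nu> \<ge> 1"
    and "\<And>i. i \<in> {1..I} \<Longrightarrow> A i < B i \<and> {A i..B i} \<subseteq> S"
    and "\<And>i. 1 \<le> i \<Longrightarrow> i < I \<Longrightarrow> B i < A (i + 1)"
    and "\<And>\<omega>. \<omega> \<in> words n \<nu> \<Longrightarrow> \<exists>i\<in>{1..I}. word_map \<theta> \<omega> ` S \<subseteq> {A i..B i}"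
    and "\<And>i. i \<in> {1..I} \<Longrightarrow> N i \<ge> 1"
    and "h = Max (mesh A B N ` {1..I})"
    and "\<mu> = h / Min (mesh A B N ` {1..I})"
    and "\<And>i. 1 \<le> i \<Longrightarrow> i < I \<Longrightarrow> 2 * (sin (pi / (2 * real r + 2)))\<^sup>2 * mesh A B N i \<le> A (i + 1) - B i"
    and "T = colloc_set A B N I r"
    and "G = E * exp (2 * s * h / chi) * (1 / fact (r + 1)) *
             (1 / (2 * cos (pi / (2 * real r + 2)))) ^ (r + 1) * (1 / 2 ^ r)"
    and "G * h ^ (r + 1) < 1"
    and "M\<^sub>1 = \<mu> * (G * h ^ r / (1 - G\<^sup>2 * h ^ (2 * r + 2))) * (1 / sin (pi / (2 * real r + 2)))\<^sup>2
             + 2 * s / chi"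
    and "H > G" and "h < 1" and "H * h ^ r < 1"
    and "M\<^sub>2 = M\<^sub>1 + G / H * (\<mu> / (1 - (G / H * h)\<^sup>2)) * (1 / (sin (pi / (2 * real r + 2)))\<^sup>2)"
    and "0 < M'" and "M' < M" and "M \<ge> M\<^sub>2"
    and "discrete_op n \<theta> g s \<nu> A B N I r ` log_lip_cone M T \<subseteq> log_lip_cone M' T"
    and "R = op_spectral_radius T (discrete_op n \<theta> g s \<nu> A B N I r)"
  shows "(inverse (1 + H * h ^ r) * R) powr (1 / real \<nu>) \<le> lambda \<and>
         lambda \<le> (inverse (1 - H * h ^ r) * R) powr (1 / real \<nu>)"
proof -
  note S = assms(2) and r = assms(5) and s_pos = assms(4) and chi_pos = assms(20)
    and E_pos = assms(19) and v_pos = assms(17) and h_def = assms(28) and \<mu>_def = assms(29)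
    and T = assms(31) and G_def = assms(32) and \<nu> = assms(23)
  have \<theta>: "\<And>p. p \<in> {1..n} \<Longrightarrow> \<theta> p ` S \<subseteq> S" using assms(7) by blast
  have g: "\<And>p t. p \<in> {1..n} \<Longrightarrow> t \<in> S \<Longrightarrow> g p t \<ge> 0" using assms(8) by blast
  interpret cm: colloc_mesh A B N I r
    by unfold_locales (use assms(5,24,25,27) in auto)
  define \<alpha> where "\<alpha> = pi / (2 * real r + 2)"
  note \<alpha> = cheb_angle[OF r, folded \<alpha>_def]
  define c where "c = 2 * s / chi"
  have c_pos: "c > 0" using s_pos chi_pos by (simp add: c_def)

  \<comment> \<open>Mesh widths and positivity of the constants\<close>
  have "replicate \<nu> 1 \<in> words n \<nu>" using \<open>n \<ge> 1\<close> by (auto simp: words_def)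
  \<comment> \<open>Existence of a word provides an interval, so that \<open>Max\<close> and
    \<open>Min\<close> of the mesh widths are taken over a nonempty set.\<close>
  then obtain i\<^sub>0 where i\<^sub>0: "i\<^sub>0 \<in> {1..I}" using assms(26) by blast
  define h\<^sub>0 where "h\<^sub>0 = Min (mesh A B N ` {1..I})"
  have fin_mesh: "finite (mesh A B N ` {1..I})" "mesh A B N ` {1..I} \<noteq> {}" using i\<^sub>0 by auto
  have h\<^sub>0: "h\<^sub>0 > 0" unfolding h\<^sub>0_def using fin_mesh cm.hh_pos by (subst Min_gr_iff) auto
  have h_ge: "mesh A B N i \<le> h" if "i \<in> {1..I}" for i
    unfolding h_def using that by (intro Max_ge) auto
  have h_pos: "h > 0" using h_ge[OF i\<^sub>0] cm.hh_pos[OF i\<^sub>0] by simp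
  have \<mu>: "\<mu> = h / h\<^sub>0" by (simp add: \<mu>_def h\<^sub>0_def)
  have \<mu>_pos: "\<mu> > 0" using h_pos h\<^sub>0 by (simp add: \<mu>)
  have G_eq: "G = E * exp (c * h) * (1 / fact (r + 1)) * (1 / (2 * cos \<alpha>)) ^ (r + 1) * (1 / 2 ^ r)"
    unfolding G_def \<alpha>_def c_def by simp
  have G_pos: "G > 0"
    unfolding G_eq using E_pos \<alpha>(3) by (intro mult_pos_pos zero_less_power divide_pos_pos fact_gt_zero) auto
  have H_pos: "H > 0" using G_pos assms(35) by simp

  \<comment> \<open>Relative interpolation error of the eigenfunction\<close>
  have cont: "continuous_on S (\<lambda>t. \<bar>nth_deriv_within S (r + 1) v t\<bar> / v t)"
    using C_class_on_continuous_on[OF assms(16), of "r + 1"] C_class_on_continuous_on[OF assms(16), of 0]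
      assms(6) v_pos by (intro continuous_intros) (fastforce simp del: nth_deriv_within.simps(2))+
  have "compact S" by (simp add: S)
  \<comment> \<open>A bound on a real supremum controls the individual values only if the set is
    bounded above; continuity on the compact S ensures this.\<close>
  hence bdd: "bdd_above ((\<lambda>t. \<bar>nth_deriv_within S (r + 1) v t\<bar> / v t) ` S)"
    using compact_continuous_image[OF cont] by (intro bounded_imp_bdd_above compact_imp_bounded)
  have E: "\<bar>nth_deriv_within S (r + 1) v t\<bar> \<le> E * v t" if t: "t \<in> S" for t
  proof -
    have "\<bar>nth_deriv_within S (r + 1) v t\<bar> / v t \<le> E"
      using cSUP_upper[OF t bdd] assms(21) by (rule order_trans)
    thus ?thesis using v_pos[OF t] by (simp add: pos_divide_le_eq del: nth_deriv_within.simps)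
  qed
  have v_lip: "v x\<^sub>1 \<le> v x\<^sub>2 * exp (c * \<bar>x\<^sub>1 - x\<^sub>2\<bar>)" if "x\<^sub>1 \<in> S" "x\<^sub>2 \<in> S" for x\<^sub>1 x\<^sub>2
    using assms(22)[OF that] by (simp add: c_def)
  have err: "\<bar>v x - pw_interp A B N I r v x\<bar> \<le> G * h ^ (r + 1) * v x"
    if "i \<in> {1..I}" "x \<in> {A i..B i}" for i x
    unfolding G_eq \<alpha>_def
    by (rule cm.pw_interp_relative_error[where a = a and b = b and m = m])
      (use assms(6,16,24) v_pos E v_lip c_pos E_pos h_ge that in \<open>auto simp: S simp del: nth_deriv_within.simps\<close>)

  \<comment> \<open>Positivity of the eigenvalue, read off at a point where the first weight does
    not vanish\<close>
  have lam_pos: "lambda > 0"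
  proof -
    obtain t where t: "t \<in> S" "g 1 t \<noteq> 0" using assms(8)[of 1] \<open>n \<ge> 1\<close> by auto
    have nonneg: "0 \<le> g p t powr s * v (\<theta> p t)" if "p \<in> {1..n}" for p
      using v_pos[of "\<theta> p t"] \<theta>[OF that] t by (intro mult_nonneg_nonneg) force+
    have "0 < g 1 t powr s * v (\<theta> 1 t)"
      using v_pos[of "\<theta> 1 t"] \<theta>[of 1] t \<open>n \<ge> 1\<close> by (intro mult_pos_pos) auto
    also have "\<dots> \<le> transfer_op n \<theta> g s v t"
      unfolding transfer_op_def using nonneg \<open>n \<ge> 1\<close>
      by (intro member_le_sum[where f = "\<lambda>p. g p t powr s * v (\<theta> p t)"]) auto
    finally show ?thesis using assms(18)[OF t(1)] v_pos[OF t(1)] by (simp add: zero_less_mult_iff)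
  qed
  define \<Lambda> where "\<Lambda> = lambda ^ \<nu>"
  have \<Lambda>_pos: "\<Lambda> > 0" using lam_pos by (simp add: \<Lambda>_def)

  \<comment> \<open>The point set and its separation\<close>
  have fin_T: "finite T" using cm.finite_T by (simp add: T)
  have T_S: "\<xi> \<in> S" if "\<xi> \<in> T" for \<xi>
  proof -
    obtain i j k where "i \<in> {1..I}" "j \<in> {1..N i}" "k \<le> r" "\<xi> = colloc_pt A B N r i j k"
      using \<open>\<xi> \<in> T\<close> unfolding T cm.T_eq by auto
    thus ?thesis using cm.cc_in[of i j k] assms(24)[of i] by blast
  qed
  \<comment> \<open>On a single point the cone condition would be void and admit negative functions;
    nonnegativity of the cone rests on two distinct points.\<close>
  obtain \<xi>\<^sub>0 \<eta>\<^sub>0 where T2: "\<xi>\<^sub>0 \<in> T" "\<eta>\<^sub>0 \<in> T" "\<xi>\<^sub>0 \<noteq> \<eta>\<^sub>0"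
  proof
    have 1: "1 \<in> {1..N i\<^sub>0}" using assms(27)[OF i\<^sub>0] by simp
    show "colloc_pt A B N r i\<^sub>0 1 0 \<in> T" "colloc_pt A B N r i\<^sub>0 1 r \<in> T"
      using cm.cc_in_T[OF i\<^sub>0 1] by (auto simp: T)
    show "colloc_pt A B N r i\<^sub>0 1 0 \<noteq> colloc_pt A B N r i\<^sub>0 1 r"
      using inj_onD[OF cm.cc_inj[OF i\<^sub>0], of 1 0 r] r by auto
  qed
  define \<delta> where "\<delta> = 2 * (sin \<alpha>)\<^sup>2 * h\<^sub>0"
  have \<delta>_pos: "\<delta> > 0" using \<alpha>(4) h\<^sub>0 by (simp add: \<delta>_def)
  have sep: "\<delta> \<le> \<bar>\<xi> - \<eta>\<bar>" if "\<xi> \<in> T" "\<eta> \<in> T" "\<xi> \<noteq> \<eta>" for \<xi> \<eta>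
    unfolding \<delta>_def h\<^sub>0_def \<alpha>_def by (rule cm.T_separated) (use assms(30) that in \<open>auto simp: T\<close>)

  \<comment> \<open>Matrix of the discrete operator\<close>
  define L where "L = discrete_op n \<theta> g s \<nu> A B N I r"
  define q where "q \<omega> \<xi> = word_weight \<theta> g \<omega> \<xi> powr s" for \<omega> \<xi>
  have L_eq: "L F \<xi> = (\<Sum>\<omega>\<in>words n \<nu>. q \<omega> \<xi> * pw_interp A B N I r F (word_map \<theta> \<omega> \<xi>))" for F \<xi>
    by (simp add: L_def discrete_op_def q_def)
  have word: "\<exists>i\<in>{1..I}. word_map \<theta> \<omega> \<xi> \<in> {A i..B i}" if "\<omega> \<in> words n \<nu>" "\<xi> \<in> T" for \<omega> \<xi>
    using assms(26)[OF that(1)] T_S[OF that(2)] by blast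
  obtain W where W: "pw_interp A B N I r F (word_map \<theta> \<omega> \<xi>) = (\<Sum>y\<in>T. W \<omega> \<xi> y * F y)"
    if "\<omega> \<in> words n \<nu>" "\<xi> \<in> T" for \<omega> \<xi> F
  proof -
    have "\<exists>W. \<forall>F. pw_interp A B N I r F (word_map \<theta> \<omega> \<xi>) = (\<Sum>y\<in>T. W y * F y)"
      if "\<omega> \<in> words n \<nu>" "\<xi> \<in> T" for \<omega> \<xi>
      using word[OF that] cm.pw_interp_kernel unfolding T by blast
    hence "\<exists>W. \<forall>\<omega> \<xi>. \<omega> \<in> words n \<nu> \<longrightarrow> \<xi> \<in> T \<longrightarrow>
        (\<forall>F. pw_interp A B N I r F (word_map \<theta> \<omega> \<xi>) = (\<Sum>y\<in>T. W \<omega> \<xi> y * F y))"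
      by metis
    thus ?thesis using that by blast
  qed
  have kern: "has_kernel_on T (\<lambda>\<xi> y. \<Sum>\<omega>\<in>words n \<nu>. q \<omega> \<xi> * W \<omega> \<xi> y) L"
    unfolding has_kernel_on_def
  proof (intro allI ballI)
    fix F \<xi> assume "\<xi> \<in> T"
    hence "L F \<xi> = (\<Sum>\<omega>\<in>words n \<nu>. \<Sum>y\<in>T. q \<omega> \<xi> * W \<omega> \<xi> y * F y)"
      by (simp add: L_eq W sum_distrib_left mult.assoc)
    also have "\<dots> = (\<Sum>y\<in>T. (\<Sum>\<omega>\<in>words n \<nu>. q \<omega> \<xi> * W \<omega> \<xi> y) * F y)"
      by (subst sum.swap) (simp add: sum_distrib_right)
    finally show "L F \<xi> = (\<Sum>y\<in>T. (\<Sum>\<omega>\<in>words n \<nu>. q \<omega> \<xi> * W \<omega> \<xi> y) * F y)" .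
  qed

  \<comment> \<open>The eigenfunction as an approximate eigenvector\<close>
  have Lv: "\<bar>\<Lambda> * v \<xi> - L v \<xi>\<bar> \<le> G * h ^ (r + 1) * (\<Lambda> * v \<xi>)" if \<xi>: "\<xi> \<in> T" for \<xi>
  proof -
    have eig: "(\<Sum>\<omega>\<in>words n \<nu>. q \<omega> \<xi> * v (word_map \<theta> \<omega> \<xi>)) = \<Lambda> * v \<xi>"
      unfolding q_def \<Lambda>_def by (rule word_sum_eigenfunction[OF \<theta> g assms(18) T_S[OF \<xi>]])
    have "\<Lambda> * v \<xi> - L v \<xi> = (\<Sum>\<omega>\<in>words n \<nu>. q \<omega> \<xi> *
        (v (word_map \<theta> \<omega> \<xi>) - pw_interp A B N I r v (word_map \<theta> \<omega> \<xi>)))"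
      unfolding eig[symmetric] L_eq by (simp add: sum_subtractf right_diff_distrib)
    \<comment> \<open>The nonnegative weights \<open>q\<close> are those of the eigenvalue equation
      for words, so summing the relative errors reproduces \<Lambda> v(\<xi>) as a factor.\<close>
    also have "\<bar>\<dots>\<bar> \<le> (\<Sum>\<omega>\<in>words n \<nu>. q \<omega> \<xi> * (G * h ^ (r + 1) * v (word_map \<theta> \<omega> \<xi>)))"
    proof (rule order_trans[OF sum_abs sum_mono])
      fix \<omega> assume \<omega>: "\<omega> \<in> words n \<nu>"
      have "\<bar>v (word_map \<theta> \<omega> \<xi>) - pw_interp A B N I r v (word_map \<theta> \<omega> \<xi>)\<bar>
          \<le> G * h ^ (r + 1) * v (word_map \<theta> \<omega> \<xi>)"
        using word[OF \<omega> \<xi>] err by blast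
      thus "\<bar>q \<omega> \<xi> * (v (word_map \<theta> \<omega> \<xi>) - pw_interp A B N I r v (word_map \<theta> \<omega> \<xi>))\<bar>
          \<le> q \<omega> \<xi> * (G * h ^ (r + 1) * v (word_map \<theta> \<omega> \<xi>))"
        unfolding abs_mult by (simp add: q_def mult_left_mono)
    qed
    also have "\<dots> = G * h ^ (r + 1) * (\<Lambda> * v \<xi>)"
      unfolding eig[symmetric] by (simp add: sum_distrib_left mult_ac)
    finally show ?thesis .
  qed

  \<comment> \<open>The perturbation constant against M\<close>
  define x where "x = G / H * h"
  have GH: "G / H < 1" "G / H > 0" using G_pos H_pos assms(35) by auto
  have x: "0 \<le> x" "x < 1"
    using GH G_pos H_pos h_pos \<open>h < 1\<close> mult_strict_mono[of "G / H" 1 h 1] by (auto simp: x_def)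
  have x2: "x\<^sup>2 < 1" using x by (simp add: abs_square_less_1)
  have pert: "2 * x / (1 - x\<^sup>2) / \<delta> = G / H * (\<mu> / (1 - x\<^sup>2)) * (1 / (sin \<alpha>)\<^sup>2)"
  proof -
    have "2 * (p * h) / d / (2 * e * h\<^sub>0) = p * (h / h\<^sub>0 / d) * (1 / e)" for p d e
      by (simp add: field_simps)
    from this[of "G / H" "1 - x\<^sup>2" "(sin \<alpha>)\<^sup>2"] show ?thesis
      by (simp only: \<delta>_def \<mu> x_def[symmetric])
  qed
  have M\<^sub>1: "M\<^sub>1 \<ge> c"
  proof -
    have "(G * h ^ (r + 1))\<^sup>2 < 1"
      using assms(33) G_pos h_pos by (simp add: abs_square_less_1)
    moreover have "2 * r + 2 = (r + 1) * 2" by simp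
    ultimately have "G\<^sup>2 * h ^ (2 * r + 2) < 1" by (simp only: power_mult power_mult_distrib)
    hence "0 \<le> \<mu> * (G * h ^ r / (1 - G\<^sup>2 * h ^ (2 * r + 2))) * (1 / sin (pi / (2 * real r + 2)))\<^sup>2"
      using \<mu>_pos G_pos h_pos by (intro mult_nonneg_nonneg divide_nonneg_nonneg) auto
    thus ?thesis unfolding assms(34) c_def by simp
  qed
  have cM: "c + 2 * x / (1 - x\<^sup>2) / \<delta> \<le> M"
    using assms(38,41) M\<^sub>1 unfolding pert by (simp add: x_def \<alpha>_def)
  \<comment> \<open>The added term is strictly positive, which gives the strict inequality c < M
    required for the order unit.\<close>
  have "0 < G / H * (\<mu> / (1 - x\<^sup>2)) * (1 / (sin \<alpha>)\<^sup>2)"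
    using G_pos H_pos \<mu>_pos x2 \<alpha>(4) by (intro mult_pos_pos divide_pos_pos) auto
  hence c_less: "c < M" using cM unfolding pert by linarith
  have M_pos: "M > 0" using c_pos c_less by simp

  \<comment> \<open>Cone membership and conclusion\<close>
  have v_cone: "(\<lambda>\<xi>. k * v \<xi>) \<in> log_lip_cone c T" if "k \<ge> 0" for k
    using v_lip T_S by (intro log_lip_cone_scale that) (auto simp: log_lip_cone_def mult.commute)
  have Hh: "0 < H * h ^ r" using H_pos h_pos by simp
  define k where "k = H * h ^ r * \<Lambda>"
  have k_pos: "k > 0" using Hh \<Lambda>_pos by (simp add: k_def)
  \<comment> \<open>The absolute values let one argument serve both signs: \<rho> v - L v = k v +
    (\<Lambda> v - L v) and L v - \<sigma> v = k v - (\<Lambda> v - L v).\<close>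
  have near: "F \<in> log_lip_cone M T"
    if F: "\<And>\<xi>. \<xi> \<in> T \<Longrightarrow> \<bar>F \<xi> - k * v \<xi>\<bar> = \<bar>\<Lambda> * v \<xi> - L v \<xi>\<bar>" for F
  proof (rule log_lip_cone_perturb[OF v_cone[of k] _ \<delta>_pos sep x _ cM])
    fix \<xi> assume \<xi>: "\<xi> \<in> T"
    have "x * (k * v \<xi>) = G * h ^ (r + 1) * (\<Lambda> * v \<xi>)"
      using H_pos by (simp add: x_def k_def field_simps)
    thus "\<bar>F \<xi> - k * v \<xi>\<bar> \<le> x * (k * v \<xi>)" using Lv[OF \<xi>] F[OF \<xi>] by linarith
    show "k * v \<xi> > 0" using k_pos v_pos[OF T_S[OF \<xi>]] by simp
  qed (use k_pos in auto)

  have cone_nonneg: "F \<xi> \<ge> 0" if "F \<in> log_lip_cone K T" "K > 0" "\<xi> \<in> T" for F K \<xi>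
    using T2 log_lip_cone_nonneg[OF that(2,3) _ _ that(1)] by metis
  have LK: "L F \<in> log_lip_cone M T" if "F \<in> log_lip_cone M T" for F
  proof -
    have "L F \<in> log_lip_cone M' T" using assms(42) that by (auto simp: L_def)
    thus ?thesis using cone_nonneg assms(39,40) by (intro log_lip_cone_mono[of M' M]) auto
  qed
  define \<sigma> \<rho> where "\<sigma> = (1 - H * h ^ r) * \<Lambda>" and "\<rho> = (1 + H * h ^ r) * \<Lambda>"
  have \<sigma>_pos: "\<sigma> > 0" using assms(37) \<Lambda>_pos by (simp add: \<sigma>_def)
  have \<rho>_pos: "\<rho> > 0" using Hh \<Lambda>_pos by (simp add: \<rho>_def)
  have bounds: "\<sigma> \<le> op_spectral_radius T L \<and> op_spectral_radius T L \<le> \<rho>"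
  proof (rule op_spectral_radius_cone_bounds[OF fin_T _ kern])
    show "T \<noteq> {}" using T2 by blast
    show "\<exists>C\<ge>0. (\<lambda>x. C * v x + f x) \<in> log_lip_cone M T" for f
      using log_lip_cone_order_unit[OF fin_T c_less] v_cone[of 1] v_pos T_S by simp
    show "(\<lambda>x. L v x - \<sigma> * v x) \<in> log_lip_cone M T"
      by (rule near) (simp add: \<sigma>_def k_def algebra_simps abs_minus_commute)
    show "(\<lambda>x. \<rho> * v x - L v x) \<in> log_lip_cone M T"
      by (rule near) (simp add: \<rho>_def k_def algebra_simps)
  qed (fact log_lip_cone_cong log_lip_cone_add log_lip_cone_scale cone_nonneg[OF _ M_pos] LK
      v_pos[OF T_S] \<sigma>_pos \<rho>_pos)+
  have R: "\<sigma> \<le> R" "R \<le> \<rho>" using bounds by (simp_all add: assms(43) L_def)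
  have root: "\<Lambda> powr (1 / real \<nu>) = lambda"
    using lam_pos \<nu> by (simp add: \<Lambda>_def powr_realpow[symmetric] powr_powr)
  have "inverse (1 + H * h ^ r) * R \<le> \<Lambda>"
    using R(2) Hh by (simp add: \<rho>_def field_simps)
  moreover have "0 \<le> inverse (1 + H * h ^ r) * R" using R(1) \<sigma>_pos Hh by simp
  moreover have "\<Lambda> \<le> inverse (1 - H * h ^ r) * R"
    using R(1) assms(37) by (simp add: \<sigma>_def field_simps)
  ultimately show ?thesis
    using powr_mono2[of "1 / real \<nu>" "inverse (1 + H * h ^ r) * R" \<Lambda>]
      powr_mono2[of "1 / real \<nu>" \<Lambda> "inverse (1 - H * h ^ r) * R"] \<Lambda>_pos root by simp
qed

end
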